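(* Let $(E,\mathcal F,\mu)$ be a nice measure space, $Q$ a symmetric bounded operator on $\mathcal L^2(\mu)$ and $V$ a positive measurable function on $E$. Then the following two assertions are equivalent: (i) $\|Qf\|_2\le\|fV\|_1$ for all $f\in\mathcal L^2(\mu)$ (the right-hand side being possibly $+\infty$); (ii) the operator $Q^2=Q\circ Q$ may be represented by a kernel density $q^2(x,y)$ with respect to $\mu$ which satisfies $$|q^2(x,y)|\le V(x)V(y)$$ for $\mu\otimes\mu$-almost every $(x,y)\in E\times E$. If (i) (equivalently (ii)) holds and moreover $V\in\mathcal L^2(\mu)$, then $Q$ is Hilbert-Schmidt, and therefore has a discrete spectrum $(\mu_n)_n$ (eigenvalues counted with multiplicity), such that $$\sum_n\mu_n^2\le\int_E V^2\,d\mu .$$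
   Context: Functions are real-valued; $\|\cdot\|_p$ is the norm of $\mathcal L^p(\mu)$; $\mu$ is a ($\sigma$-finite) measure of finite or infinite mass. Nice measure space: $(E,\mathcal F,\mu)$ is called nice if every bounded operator from $\mathcal L^1(\mu)$ to $\mathcal L^\infty(\mu)$ with norm $C$ can be represented by a kernel density with respect to $\mu$ which is bounded in absolute value by $C$, $\mu\otimes\mu$-almost everywhere (this holds for instance if $\mathcal F$ is generated, up to null sets, by a countable family). "$Q^2$ is represented by the kernel density $q^2$ with respect to $\mu$" means that $q^2$ is a measurable function on $E\times E$ (the superscript is part of the name, not a square) with $Q(Qf)(x)=\int_E q^2(x,y)f(y)\,d\mu(y)$ for $\mu$-almost every $x$, for every $f\in\mathcal L^2(\mu)$ with $\int|f|V\,d\mu<\infty$ (so that, under the bound in (ii), the integral converges absolutely). *)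

theory Defs
  imports "HOL-Probability.Essential_Supremum"
begin

text \<open>
  Elements of \<open>L\<^sup>p(\<mu>)\<close> are represented by functions; all notions below are invariant under
  modification on null sets.  An operator on classes is represented by any map on functions that
  induces it, so linearity and compatibility with classes are required almost everywhere only.
  Norms take values in \<^typ>\<open>ennreal\<close>, so that they may be infinite.
\<close>

definition Lp_norm :: "ennreal \<Rightarrow> 'a measure \<Rightarrow> ('a \<Rightarrow> real) \<Rightarrow> ennreal" where
  "Lp_norm p M f =
     (if p = \<infinity> then esssup M (\<lambda>x. ennreal \<bar>f x\<bar>)
      else let I = (\<integral>\<^sup>+ x. ennreal (\<bar>f x\<bar> powr enn2real p) \<partial>M)
           in if I = \<infinity> then \<infinity> else ennreal (enn2real I powr (1 / enn2real p)))"

definition Lp_space :: "ennreal \<Rightarrow> 'a measure \<Rightarrow> ('a \<Rightarrow> real) set" where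
  "Lp_space p M = {f \<in> borel_measurable M. Lp_norm p M f < \<infinity>}"

definition op_norm ::
  "ennreal \<Rightarrow> ennreal \<Rightarrow> 'a measure \<Rightarrow> (('a \<Rightarrow> real) \<Rightarrow> ('a \<Rightarrow> real)) \<Rightarrow> ennreal" where
  "op_norm p r M T = Inf {C. \<forall>f \<in> Lp_space p M. Lp_norm r M (T f) \<le> C * Lp_norm p M f}"

definition bounded_operator ::
  "ennreal \<Rightarrow> ennreal \<Rightarrow> 'a measure \<Rightarrow> (('a \<Rightarrow> real) \<Rightarrow> ('a \<Rightarrow> real)) \<Rightarrow> bool" where
  "bounded_operator p r M T \<longleftrightarrow>
     T \<in> Lp_space p M \<rightarrow> Lp_space r M \<and>
     (\<forall>f \<in> Lp_space p M. \<forall>g \<in> Lp_space p M.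
        (AE x in M. f x = g x) \<longrightarrow> (AE x in M. T f x = T g x)) \<and>
     (\<forall>f \<in> Lp_space p M. \<forall>g \<in> Lp_space p M.
        AE x in M. T (\<lambda>y. f y + g y) x = T f x + T g x) \<and>
     (\<forall>f \<in> Lp_space p M. \<forall>c. AE x in M. T (\<lambda>y. c * f y) x = c * T f x) \<and>
     op_norm p r M T < \<infinity>"

definition L2_inner :: "'a measure \<Rightarrow> ('a \<Rightarrow> real) \<Rightarrow> ('a \<Rightarrow> real) \<Rightarrow> real" where
  "L2_inner M f g = (\<integral>x. f x * g x \<partial>M)"

definition symmetric_operator :: "'a measure \<Rightarrow> (('a \<Rightarrow> real) \<Rightarrow> ('a \<Rightarrow> real)) \<Rightarrow> bool" where
  "symmetric_operator M T \<longleftrightarrow>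
     (\<forall>f \<in> Lp_space 2 M. \<forall>g \<in> Lp_space 2 M. L2_inner M (T f) g = L2_inner M f (T g))"

text \<open>
  \<open>D\<close> is the set of functions on which the operator is required to be given by the kernel.  The
  integrability clause is needed because the Bochner integral of a non-integrable function is 0.
\<close>

definition represented_by_kernel ::
  "'a measure \<Rightarrow> ('a \<Rightarrow> real) set \<Rightarrow> (('a \<Rightarrow> real) \<Rightarrow> ('a \<Rightarrow> real)) \<Rightarrow> ('a \<times> 'a \<Rightarrow> real) \<Rightarrow> bool" where
  "represented_by_kernel M D T k \<longleftrightarrow>
     k \<in> borel_measurable (M \<Otimes>\<^sub>M M) \<and>
     (\<forall>f \<in> D. AE x in M. integrable M (\<lambda>y. k (x, y) * f y) \<and>
                           T f x = (\<integral>y. k (x, y) * f y \<partial>M))"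

definition nice_measure_space :: "'a measure \<Rightarrow> bool" where
  "nice_measure_space M \<longleftrightarrow>
     (\<forall>T. bounded_operator 1 \<infinity> M T \<longrightarrow>
        (\<exists>k. represented_by_kernel M (Lp_space 1 M) T k \<and>
             (AE z in M \<Otimes>\<^sub>M M. ennreal \<bar>k z\<bar> \<le> op_norm 1 \<infinity> M T)))"

text \<open>
  Orthonormal basis of a closed subspace \<open>W\<close> of \<open>L\<^sup>2\<close>, as a complete orthonormal system.  Distinct
  members of \<open>B\<close> are orthogonal, so they represent distinct classes.  \<open>L\<^sup>2\<close> need not be separable,
  so \<open>B\<close> may be uncountable.
\<close>

definition orthonormal_basis :: "'a measure \<Rightarrow> ('a \<Rightarrow> real) set \<Rightarrow> ('a \<Rightarrow> real) set \<Rightarrow> bool" where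
  "orthonormal_basis M W B \<longleftrightarrow>
     B \<subseteq> W \<and>
     (\<forall>e \<in> B. \<forall>e' \<in> B. L2_inner M e e' = (if e = e' then 1 else 0)) \<and>
     (\<forall>f \<in> W. (\<forall>e \<in> B. L2_inner M f e = 0) \<longrightarrow> (AE x in M. f x = 0))"

definition Hilbert_Schmidt :: "'a measure \<Rightarrow> (('a \<Rightarrow> real) \<Rightarrow> ('a \<Rightarrow> real)) \<Rightarrow> bool" where
  "Hilbert_Schmidt M T \<longleftrightarrow>
     bounded_operator 2 2 M T \<and>
     (\<exists>B. orthonormal_basis M (Lp_space 2 M) B \<and> (\<Sum>\<^sub>\<infinity>e\<in>B. (Lp_norm 2 M (T e))\<^sup>2) < \<infinity>)"

text \<open>The real spectrum, which is the whole spectrum when \<open>T\<close> is symmetric.\<close>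

definition spectrum :: "'a measure \<Rightarrow> (('a \<Rightarrow> real) \<Rightarrow> ('a \<Rightarrow> real)) \<Rightarrow> real set" where
  "spectrum M T = {l. \<not> (\<exists>R. bounded_operator 2 2 M R \<and>
     (\<forall>f \<in> Lp_space 2 M.
        (AE x in M. R (\<lambda>y. T f y - l * f y) x = f x) \<and>
        (AE x in M. T (R f) x - l * R f x = f x)))}"

definition eigenspace ::
  "'a measure \<Rightarrow> (('a \<Rightarrow> real) \<Rightarrow> ('a \<Rightarrow> real)) \<Rightarrow> real \<Rightarrow> ('a \<Rightarrow> real) set" where
  "eigenspace M T l = {f \<in> Lp_space 2 M. AE x in M. T f x = l * f x}"

text \<open>
  The spectrum of \<open>T\<close> is discrete (away from its only possible accumulation point 0), and the family
  \<open>(ev e)\<^sub>e\<^sub>\<in>\<^sub>B\<close> lists the eigenvalues with multiplicity: every \<open>l\<close> occurs exactly as often as the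
  dimension of its eigenspace.  The family is indexed by an orthonormal basis of eigenfunctions
  rather than by the natural numbers because the eigenvalue 0 may have uncountable multiplicity;
  the finiteness clause makes the family of the nonzero eigenvalues a finite or infinite sequence
  tending to 0.
\<close>

definition discrete_spectrum ::
  "'a measure \<Rightarrow> (('a \<Rightarrow> real) \<Rightarrow> ('a \<Rightarrow> real)) \<Rightarrow> ('a \<Rightarrow> real) set \<Rightarrow> (('a \<Rightarrow> real) \<Rightarrow> real) \<Rightarrow> bool" where
  "discrete_spectrum M T B ev \<longleftrightarrow>
     orthonormal_basis M (Lp_space 2 M) B \<and>
     (\<forall>l. orthonormal_basis M (eigenspace M T l) {e \<in> B. ev e = l}) \<and>
     spectrum M T - {0} = ev ` B - {0} \<and>
     (\<forall>\<epsilon>>0. finite {e \<in> B. \<epsilon> \<le> \<bar>ev e\<bar>})"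

end

(*
  Testing the domination ||Qf||_2 <= ||fV||_1 on Q u restricted to {|Q u| > ||u|| V} shows that it
  amounts to the pointwise bound |Q u| <= ||u|| V for all u.  Hence J : h |-> Q (h / V) extends to
  L^1, and h |-> Q (J h) / V is a contraction from L^1 to L^\<infinity>, whose kernel, multiplied by
  V(x) V(y), is the kernel of Q^2.  Conversely, the kernel bound gives |Q^2 f| <= ||fV||_1 V, and
  ||Qf||^2 = <Q^2 f, f>.

  For V in L^2, the pointwise bound applied to combinations of a finite orthonormal family F gives
  sum_F (Q e)^2 <= V^2, hence sum_F ||Q e||^2 <= int V^2.  Choosing F nearly optimal makes Q small
  on the orthogonal complement of F.  Thus, for l \<noteq> 0, Q - l is bounded below up to finitely many
  dimensions, so it is bounded below on every closed subspace without eigenvectors for l.  On an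
  invariant subspace without eigenvectors this excludes that +-||Q|| are approximate eigenvalues,
  so Q vanishes there; orthonormal bases of the eigenspaces therefore span, and off the eigenvalues
  Q - l is invertible.
*)
theory Submission
  imports Defs
begin

section \<open>The space of square integrable functions\<close>

text \<open>In the equivalence \<open>V\<close> may fail to be square integrable and may come
  arbitrarily close to 0, so neither \<open>V\<close> nor h / V is available as an argument of
  \<open>Q\<close>. Each test function is therefore cut off by comparison with \<open>V\<close>
  itself: the set {|Q u| > ||u|| V} makes |f| V integrable, and {|h| \<le> n V^2} makes h / V square
  integrable. The contraction from L^1 to L^\<infinity> is a product of two: u |-> Q u / V contracts
  L^2 into L^\<infinity> by the pointwise bound, and J contracts L^1 into L^2 because it is the
  transpose of that map. L^2 may be nonseparable, so orthonormal families are controlled through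
  bounds on their finite subfamilies. Compactness is replaced by inequalities ||(Q - l) u|| \<ge> c
  ||u||: they make a nearest point in the image of a closed subspace exist, by the parallelogram
  law, and such nearest points serve both to extend the inequality by one dimension and to solve (Q
  - l) u = f.\<close>

lemma Lp_norm_1: "Lp_norm 1 M f = (\<integral>\<^sup>+x. ennreal \<bar>f x\<bar> \<partial>M)"
  by (auto simp: Lp_norm_def Let_def less_top)

lemma Lp_space_1: "f \<in> Lp_space 1 M \<longleftrightarrow> integrable M f"
  by (auto simp: Lp_space_def Lp_norm_1 integrable_iff_bounded less_top)

lemma Lp_space_2: "f \<in> Lp_space 2 M \<longleftrightarrow> f \<in> borel_measurable M \<and> integrable M (\<lambda>x. f x * f x)"
proof -
  have "(\<integral>\<^sup>+x. ennreal (\<bar>f x\<bar> powr 2) \<partial>M) = (\<integral>\<^sup>+x. ennreal (norm (f x * f x)) \<partial>M)"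
    by (rule nn_integral_cong) (simp add: abs_mult[symmetric] power2_eq_square)
  then show ?thesis
    unfolding Lp_space_def Lp_norm_def
    by (auto simp: Let_def integrable_iff_bounded less_top[symmetric] split: if_splits)
qed

lemma Lp_space_2_measurable [measurable_dest]:
  "f \<in> Lp_space 2 M \<Longrightarrow> f \<in> borel_measurable M"
  by (simp add: Lp_space_2)

section \<open>Real inner product and norm on L^2\<close>

definition L2_norm :: "'a measure \<Rightarrow> ('a \<Rightarrow> real) \<Rightarrow> real" where
  "L2_norm M f = sqrt (L2_inner M f f)"

lemma L2_inner_self_ge_0 [simp]: "0 \<le> L2_inner M f f"
  by (simp add: L2_inner_def)

lemma L2_norm_ge_0 [simp]: "0 \<le> L2_norm M f"
  by (simp add: L2_norm_def)

lemma L2_norm_sq: "(L2_norm M f)\<^sup>2 = L2_inner M f f"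
  by (simp add: L2_norm_def)

lemma Lp_norm_2:
  assumes "f \<in> Lp_space 2 M"
  shows "Lp_norm 2 M f = ennreal (L2_norm M f)"
proof -
  have "(\<integral>\<^sup>+x. ennreal (\<bar>f x\<bar> powr 2) \<partial>M) = (\<integral>\<^sup>+x. ennreal (f x * f x) \<partial>M)"
    by (rule nn_integral_cong) (simp add: power2_eq_square)
  also have "\<dots> = ennreal (L2_inner M f f)"
    using assms unfolding L2_inner_def by (intro nn_integral_eq_integral) (auto simp: Lp_space_2)
  finally show ?thesis
    by (simp add: Lp_norm_def Let_def L2_norm_def powr_half_sqrt L2_inner_def)
qed

lemma L2_mult_integrable:
  assumes "f \<in> Lp_space 2 M" "g \<in> Lp_space 2 M"
  shows "integrable M (\<lambda>x. f x * g x)"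
proof (rule Bochner_Integration.integrable_bound)
  show "integrable M (\<lambda>x. f x * f x + g x * g x)" "(\<lambda>x. f x * g x) \<in> borel_measurable M"
    using assms by (auto simp: Lp_space_2)
  have "\<bar>a * b\<bar> \<le> a * a + b * b" for a b :: real
  proof -
    have "2 * (\<bar>a\<bar> * \<bar>b\<bar>) \<le> \<bar>a\<bar> * \<bar>a\<bar> + \<bar>b\<bar> * \<bar>b\<bar>"
      using zero_le_square[of "\<bar>a\<bar> - \<bar>b\<bar>"] by (simp add: algebra_simps)
    moreover have "0 \<le> \<bar>a\<bar> * \<bar>b\<bar>" by simp
    ultimately show ?thesis by (simp only: abs_mult abs_mult_self_eq)
  qed
  then show "AE x in M. norm (f x * g x) \<le> norm (f x * f x + g x * g x)"
    by simp
qed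

lemma L2_scale:
  assumes "f \<in> Lp_space 2 M"
  shows "(\<lambda>x. c * f x) \<in> Lp_space 2 M"
proof -
  have "(\<lambda>x. c * f x * (c * f x)) = (\<lambda>x. c * c * (f x * f x))"
    by (simp add: mult_ac)
  moreover have "(\<lambda>x. c * f x) \<in> borel_measurable M"
    using assms by measurable
  ultimately show ?thesis
    using assms unfolding Lp_space_2 by (metis integrable_mult_right)
qed

lemma L2_add:
  assumes "f \<in> Lp_space 2 M" "g \<in> Lp_space 2 M"
  shows "(\<lambda>x. f x + g x) \<in> Lp_space 2 M"
  using assms L2_mult_integrable[OF assms] L2_mult_integrable[OF assms(2,1)]
  by (auto simp: Lp_space_2 ring_distribs)

lemma L2_diff:
  assumes "f \<in> Lp_space 2 M" "g \<in> Lp_space 2 M"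
  shows "(\<lambda>x. f x - g x) \<in> Lp_space 2 M"
  using L2_add[OF assms(1) L2_scale[OF assms(2), of "-1"]] by simp

lemma L2_zero: "(\<lambda>x. 0) \<in> Lp_space 2 M"
  by (simp add: Lp_space_2)

lemma L2_sum:
  assumes "\<And>i. i \<in> F \<Longrightarrow> f i \<in> Lp_space 2 M"
  shows "(\<lambda>x. \<Sum>i\<in>F. f i x) \<in> Lp_space 2 M"
  using assms
  by (induction F rule: infinite_finite_induct) (auto intro!: L2_zero L2_add)

lemma L2_bound:
  assumes "f \<in> Lp_space 2 M" "g \<in> borel_measurable M" "AE x in M. \<bar>g x\<bar> \<le> \<bar>f x\<bar>"
  shows "g \<in> Lp_space 2 M"
proof -
  have "integrable M (\<lambda>x. g x * g x)"
  proof (rule Bochner_Integration.integrable_bound)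
    show "integrable M (\<lambda>x. f x * f x)" using assms by (simp add: Lp_space_2)
    show "AE x in M. norm (g x * g x) \<le> norm (f x * f x)"
      using assms(3)
    proof eventually_elim
      case (elim x)
      then have "\<bar>g x\<bar> * \<bar>g x\<bar> \<le> \<bar>f x\<bar> * \<bar>f x\<bar>"
        by (intro mult_mono) auto
      then show ?case by (simp only: real_norm_def abs_mult)
    qed
  qed (use assms in measurable)
  with assms show ?thesis by (simp add: Lp_space_2)
qed

lemma L2_inner_commute: "L2_inner M f g = L2_inner M g f"
  by (simp add: L2_inner_def mult.commute)

lemma L2_inner_scale_left: "L2_inner M (\<lambda>x. c * f x) g = c * L2_inner M f g"
  by (simp add: L2_inner_def mult.assoc)

lemma L2_inner_scale_right: "L2_inner M f (\<lambda>x. c * g x) = c * L2_inner M f g"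
  by (simp add: L2_inner_def mult.left_commute)

lemma L2_inner_add_left:
  assumes "f \<in> Lp_space 2 M" "g \<in> Lp_space 2 M" "h \<in> Lp_space 2 M"
  shows "L2_inner M (\<lambda>x. f x + g x) h = L2_inner M f h + L2_inner M g h"
  using assms by (simp add: L2_inner_def ring_distribs L2_mult_integrable)

lemma L2_inner_add_right:
  assumes "f \<in> Lp_space 2 M" "g \<in> Lp_space 2 M" "h \<in> Lp_space 2 M"
  shows "L2_inner M h (\<lambda>x. f x + g x) = L2_inner M h f + L2_inner M h g"
  using assms by (simp add: L2_inner_def ring_distribs L2_mult_integrable)

lemma L2_inner_diff_left:
  assumes "f \<in> Lp_space 2 M" "g \<in> Lp_space 2 M" "h \<in> Lp_space 2 M"
  shows "L2_inner M (\<lambda>x. f x - g x) h = L2_inner M f h - L2_inner M g h"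
  using assms by (simp add: L2_inner_def ring_distribs L2_mult_integrable)

lemma L2_inner_diff_right:
  assumes "f \<in> Lp_space 2 M" "g \<in> Lp_space 2 M" "h \<in> Lp_space 2 M"
  shows "L2_inner M h (\<lambda>x. f x - g x) = L2_inner M h f - L2_inner M h g"
  using assms by (simp add: L2_inner_def ring_distribs L2_mult_integrable)

lemma L2_inner_zero_left [simp]: "L2_inner M (\<lambda>x. 0) g = 0"
  by (simp add: L2_inner_def)

lemma L2_inner_sum_right:
  assumes "\<And>i. i \<in> F \<Longrightarrow> f i \<in> Lp_space 2 M" "h \<in> Lp_space 2 M"
  shows "L2_inner M h (\<lambda>x. \<Sum>i\<in>F. f i x) = (\<Sum>i\<in>F. L2_inner M h (f i))"
  using assms by (simp add: L2_inner_def sum_distrib_left L2_mult_integrable)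

lemma L2_inner_cong_AE:
  assumes "f \<in> Lp_space 2 M" "f' \<in> Lp_space 2 M" "g \<in> Lp_space 2 M" "g' \<in> Lp_space 2 M"
    and "AE x in M. f x = f' x" "AE x in M. g x = g' x"
  shows "L2_inner M f g = L2_inner M f' g'"
  unfolding L2_inner_def
proof (rule integral_cong_AE)
  show "AE x in M. f x * g x = f' x * g' x"
    using assms(5,6) by eventually_elim simp
qed (use assms(1-4) in measurable)

lemma L2_norm_cong_AE:
  assumes "f \<in> Lp_space 2 M" "g \<in> Lp_space 2 M" "AE x in M. f x = g x"
  shows "L2_norm M f = L2_norm M g"
  unfolding L2_norm_def using L2_inner_cong_AE[OF assms(1,2,1,2,3,3)] by simp

lemma L2_norm_eq_0_iff:
  assumes "f \<in> Lp_space 2 M"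
  shows "L2_norm M f = 0 \<longleftrightarrow> (AE x in M. f x = 0)"
  using assms unfolding L2_norm_def L2_inner_def
  by (simp add: integral_nonneg_eq_0_iff_AE Lp_space_2)

lemma L2_norm_scale: "L2_norm M (\<lambda>x. c * f x) = \<bar>c\<bar> * L2_norm M f"
  by (simp add: L2_norm_def L2_inner_scale_left L2_inner_scale_right real_sqrt_mult
      flip: mult.assoc)

lemma L2_norm_add_sq:
  assumes "f \<in> Lp_space 2 M" "g \<in> Lp_space 2 M"
  shows "(L2_norm M (\<lambda>x. f x + g x))\<^sup>2
         = (L2_norm M f)\<^sup>2 + 2 * L2_inner M f g + (L2_norm M g)\<^sup>2"
  using assms L2_inner_commute[of M g f]
  by (simp add: L2_norm_sq L2_inner_add_left L2_inner_add_right L2_add)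

lemma L2_norm_diff_sq:
  assumes "f \<in> Lp_space 2 M" "g \<in> Lp_space 2 M"
  shows "(L2_norm M (\<lambda>x. f x - g x))\<^sup>2
         = (L2_norm M f)\<^sup>2 - 2 * L2_inner M f g + (L2_norm M g)\<^sup>2"
  using assms L2_inner_commute[of M g f]
  by (simp add: L2_norm_sq L2_inner_diff_left L2_inner_diff_right L2_diff)

text \<open>Nonnegativity of the quadratic form (s, t) |-> ||s f - t g||^2. The degenerate case
  ||g|| = 0 is settled by the same form, with a value of t that would make it equal to -1 if <f, g>
  were nonzero.\<close>

lemma L2_Cauchy_Schwarz:
  assumes f: "f \<in> Lp_space 2 M" and g: "g \<in> Lp_space 2 M"
  shows "\<bar>L2_inner M f g\<bar> \<le> L2_norm M f * L2_norm M g"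
proof -
  let ?a = "(L2_norm M f)\<^sup>2" and ?b = "(L2_norm M g)\<^sup>2" and ?i = "L2_inner M f g"
  have *: "0 \<le> s\<^sup>2 * ?a - 2 * s * t * ?i + t\<^sup>2 * ?b" for s t
    using L2_norm_diff_sq[OF L2_scale[OF f, of s] L2_scale[OF g, of t]]
      zero_le_power2[of "L2_norm M (\<lambda>x. s * f x - t * g x)"]
    by (simp add: L2_norm_scale L2_inner_scale_left L2_inner_scale_right power_mult_distrib)
  have "?i\<^sup>2 \<le> ?a * ?b"
  proof (cases "?b = 0")
    case True
    have "?i = 0"
    proof (rule ccontr)
      assume "?i \<noteq> 0"
      with *[of 1 "(?a + 1) / (2 * ?i)"] True show False by (simp add: field_simps)
    qed
    then show ?thesis by simp
  next
    case False
    then have "0 < ?b" by (simp add: zero_less_power2)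
    \<comment> \<open>The value of the form at s = ||g||^2, t = <f, g>, its minimiser in t for this
      s.\<close>
    moreover have "0 \<le> ?b * (?a * ?b - ?i\<^sup>2)"
      using *[of ?b ?i] by (simp add: power2_eq_square algebra_simps)
    ultimately show ?thesis by (simp add: zero_le_mult_iff)
  qed
  then have "\<bar>?i\<bar>\<^sup>2 \<le> (L2_norm M f * L2_norm M g)\<^sup>2"
    by (simp add: power_mult_distrib)
  then show ?thesis
    by (rule power2_le_imp_le) simp
qed

lemma L2_norm_triangle:
  assumes "f \<in> Lp_space 2 M" "g \<in> Lp_space 2 M"
  shows "L2_norm M (\<lambda>x. f x + g x) \<le> L2_norm M f + L2_norm M g"
proof (rule power2_le_imp_le)
  show "(L2_norm M (\<lambda>x. f x + g x))\<^sup>2 \<le> (L2_norm M f + L2_norm M g)\<^sup>2"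
    using L2_norm_add_sq[OF assms] L2_Cauchy_Schwarz[OF assms] by (simp add: power2_sum)
qed simp

lemma L2_norm_minus_commute: "L2_norm M (\<lambda>x. f x - g x) = L2_norm M (\<lambda>x. g x - f x)"
  using L2_norm_scale[of M "-1" "\<lambda>x. f x - g x"] by simp

lemma L2_norm_triangle_diff:
  assumes "f \<in> Lp_space 2 M" "g \<in> Lp_space 2 M"
  shows "L2_norm M f \<le> L2_norm M (\<lambda>x. f x - g x) + L2_norm M g"
  using L2_norm_triangle[OF L2_diff[OF assms] assms(2)] by simp

lemma L2_norm_diff_le:
  assumes "f \<in> Lp_space 2 M" "g \<in> Lp_space 2 M"
  shows "L2_norm M (\<lambda>x. f x - g x) \<le> L2_norm M f + L2_norm M g"
  using L2_norm_triangle[OF assms(1) L2_scale[OF assms(2), of "-1"]] L2_norm_scale[of M "-1" g]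
  by simp

lemma L2_parallelogram:
  assumes "f \<in> Lp_space 2 M" "g \<in> Lp_space 2 M"
  shows "(L2_norm M (\<lambda>x. f x - g x))\<^sup>2 + (L2_norm M (\<lambda>x. f x + g x))\<^sup>2
         = 2 * (L2_norm M f)\<^sup>2 + 2 * (L2_norm M g)\<^sup>2"
  using assms by (simp add: L2_norm_add_sq L2_norm_diff_sq)

text \<open>Sigma-finiteness supplies a strictly positive integrable \<open>p\<close>, hence a
  weight \<open>w = sqrt p\<close> in L^2. By Cauchy-Schwarz the products u_n w are Cauchy in L^1,
  so a subsequence converges almost everywhere, and division by \<open>w\<close> returns to u_n.
  Fatou's lemma turns this into norm convergence of the whole sequence.\<close>

lemma (in sigma_finite_measure) L2_complete:
  fixes u :: "nat \<Rightarrow> 'a \<Rightarrow> real"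
  assumes u: "\<And>n. u n \<in> Lp_space 2 M"
    and Cauchy: "\<And>e. 0 < e \<Longrightarrow> \<exists>N. \<forall>m\<ge>N. \<forall>n\<ge>N. L2_norm M (\<lambda>x. u m x - u n x) < e"
  obtains v where "v \<in> Lp_space 2 M" "(\<lambda>n. L2_norm M (\<lambda>x. u n x - v x)) \<longlonglongrightarrow> 0"
proof -
  note [measurable] = Lp_space_2_measurable[OF u]
  obtain p :: "'a \<Rightarrow> real" where p: "p \<in> borel_measurable M" "\<And>x. 0 < p x" "integrable M p"
    using obtain_positive_integrable_function by metis
  define w where "w = (\<lambda>x. sqrt (p x))"
  have w: "w \<in> Lp_space 2 M" and w_pos: "0 < w x" for x
    using p by (auto simp: w_def Lp_space_2 less_imp_le)
  have *: "(\<integral>x. norm (u m x * w x - u n x * w x) \<partial>M)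
           \<le> L2_norm M (\<lambda>x. u m x - u n x) * L2_norm M w" for m n
  proof -
    have d: "(\<lambda>x. \<bar>u m x - u n x\<bar>) \<in> Lp_space 2 M"
      using L2_diff[OF u u, of m n] by (simp add: Lp_space_2)
    have "(\<integral>x. norm (u m x * w x - u n x * w x) \<partial>M)
          = L2_inner M (\<lambda>x. \<bar>u m x - u n x\<bar>) w"
      unfolding L2_inner_def
      by (rule Bochner_Integration.integral_cong)
         (auto simp: abs_mult less_imp_le[OF w_pos] simp flip: left_diff_distrib)
    also have "\<dots> \<le> L2_norm M (\<lambda>x. \<bar>u m x - u n x\<bar>) * L2_norm M w"
      using L2_Cauchy_Schwarz[OF d w] by simp
    also have "L2_norm M (\<lambda>x. \<bar>u m x - u n x\<bar>) = L2_norm M (\<lambda>x. u m x - u n x)"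
      by (simp add: L2_norm_def L2_inner_def)
    finally show ?thesis .
  qed
  obtain r where r: "strict_mono r" and AE_Cauchy: "AE x in M. Cauchy (\<lambda>i. u (r i) x * w x)"
  proof (rule cauchy_L1_AE_cauchy_subseq[of M "\<lambda>n x. u n x * w x"])
    show "integrable M (\<lambda>x. u n x * w x)" for n
      using L2_mult_integrable[OF u w] .
    fix e :: real assume "0 < e"
    \<comment> \<open>The summand 1 keeps the divisor positive: the norm of \<open>w\<close> is 0
      when \<open>M\<close> is the zero measure.\<close>
    then have "0 < e / (L2_norm M w + 1)"
      by (simp add: add_nonneg_pos)
    then obtain N where N: "\<And>m n. N \<le> m \<Longrightarrow> N \<le> n \<Longrightarrow>
        L2_norm M (\<lambda>x. u m x - u n x) < e / (L2_norm M w + 1)"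
      using Cauchy by blast
    have "(\<integral>x. norm (u m x * w x - u n x * w x) \<partial>M) < e" if "N \<le> m" "N \<le> n" for m n
    proof -
      have "L2_norm M (\<lambda>x. u m x - u n x) * L2_norm M w
            \<le> L2_norm M (\<lambda>x. u m x - u n x) * (L2_norm M w + 1)"
        by (simp add: mult_left_mono)
      also have "\<dots> < e"
        using N[OF that] by (simp add: pos_less_divide_eq add_nonneg_pos)
      finally show ?thesis using *[of m n] by simp
    qed
    then show "\<exists>N. \<forall>m\<ge>N. \<forall>n\<ge>N. (\<integral>x. norm (u m x * w x - u n x * w x) \<partial>M) < e"
      by blast
  qed
  define v where "v = (\<lambda>x. lim (\<lambda>i. u (r i) x))"
  have v [measurable]: "v \<in> borel_measurable M"
    unfolding v_def by measurable
  have lim: "AE x in M. (\<lambda>i. u (r i) x) \<longlonglongrightarrow> v x"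
    using AE_Cauchy
  proof eventually_elim
    case (elim x)
    then obtain l where "(\<lambda>i. u (r i) x * w x) \<longlonglongrightarrow> l"
      using Cauchy_convergent_iff convergent_def by blast
    then have "(\<lambda>i. u (r i) x * w x / w x) \<longlonglongrightarrow> l / w x"
      by (intro tendsto_intros) (use w_pos[of x] in auto)
    then have "convergent (\<lambda>i. u (r i) x)"
      using w_pos[of x] by (auto simp: convergent_def)
    then show ?case
      by (simp add: v_def convergent_LIMSEQ_iff)
  qed
  \<comment> \<open>Fatou's lemma along the subsequence\<close>
  have bound: "(\<integral>\<^sup>+x. ennreal ((u n x - v x) * (u n x - v x)) \<partial>M) \<le> ennreal (e\<^sup>2)"
    if "\<And>m. N \<le> m \<Longrightarrow> L2_norm M (\<lambda>x. u n x - u m x) \<le> e" for n N e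
  proof -
    have "(\<integral>\<^sup>+x. ennreal ((u n x - v x) * (u n x - v x)) \<partial>M)
          = (\<integral>\<^sup>+x. liminf (\<lambda>i. ennreal ((u n x - u (r i) x) * (u n x - u (r i) x))) \<partial>M)"
    proof (rule nn_integral_cong_AE)
      show "AE x in M. ennreal ((u n x - v x) * (u n x - v x))
            = liminf (\<lambda>i. ennreal ((u n x - u (r i) x) * (u n x - u (r i) x)))"
        using lim
      proof eventually_elim
        case (elim x)
        then have "(\<lambda>i. ennreal ((u n x - u (r i) x) * (u n x - u (r i) x)))
                   \<longlonglongrightarrow> ennreal ((u n x - v x) * (u n x - v x))"
          by (intro tendsto_intros)
        then show ?case by (intro lim_imp_Liminf[symmetric]) auto
      qed
    qed
    also have "\<dots> \<le> liminf (\<lambda>i. \<integral>\<^sup>+x. ennreal ((u n x - u (r i) x) * (u n x - u (r i) x)) \<partial>M)"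
      by (rule nn_integral_liminf) measurable
    also have "\<dots> = liminf (\<lambda>i. ennreal ((L2_norm M (\<lambda>x. u n x - u (r i) x))\<^sup>2))"
      using L2_diff[OF u u]
      by (simp add: L2_norm_sq L2_inner_def nn_integral_eq_integral Lp_space_2)
    also have "\<dots> \<le> ennreal (e\<^sup>2)"
    proof (rule Liminf_le)
      have "L2_norm M (\<lambda>x. u n x - u (r i) x) \<le> e" if "N \<le> i" for i
        using \<open>\<And>m. N \<le> m \<Longrightarrow> _\<close> seq_suble[OF r, of i] that by (meson order_trans)
      then show "\<forall>\<^sub>F i in sequentially.
          ennreal ((L2_norm M (\<lambda>x. u n x - u (r i) x))\<^sup>2) \<le> ennreal (e\<^sup>2)"
        unfolding eventually_sequentially
        by (intro exI[of _ N] allI impI ennreal_leI power_mono) auto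
    qed simp
    finally show ?thesis .
  qed
  have diff_L2: "(\<lambda>x. u n x - v x) \<in> Lp_space 2 M"
    and diff_le: "L2_norm M (\<lambda>x. u n x - v x) \<le> e"
    if "0 \<le> e" "\<And>m. N \<le> m \<Longrightarrow> L2_norm M (\<lambda>x. u n x - u m x) \<le> e" for n N e
  proof -
    have fin: "(\<integral>\<^sup>+x. ennreal ((u n x - v x) * (u n x - v x)) \<partial>M) \<le> ennreal (e\<^sup>2)"
      using that bound by blast
    then have "(\<integral>\<^sup>+x. ennreal ((u n x - v x) * (u n x - v x)) \<partial>M) < \<infinity>"
      by (simp add: order_le_less_trans)
    then show L2: "(\<lambda>x. u n x - v x) \<in> Lp_space 2 M"
      by (auto simp: Lp_space_2 integrable_iff_bounded)
    have "ennreal ((L2_norm M (\<lambda>x. u n x - v x))\<^sup>2) \<le> ennreal (e\<^sup>2)"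
      using fin L2 by (simp add: L2_norm_sq L2_inner_def nn_integral_eq_integral Lp_space_2)
    then show "L2_norm M (\<lambda>x. u n x - v x) \<le> e"
      using \<open>0 \<le> e\<close> by (intro power2_le_imp_le[OF _ \<open>0 \<le> e\<close>]) simp
  qed
  \<comment> \<open>Square integrability of \<open>v\<close> comes from v = u_N - (u_N - v); the
    difference in brackets is covered by the Fatou estimate with bound 1.\<close>
  obtain N where "\<And>m n. N \<le> m \<Longrightarrow> N \<le> n \<Longrightarrow> L2_norm M (\<lambda>x. u m x - u n x) < 1"
    using Cauchy[of 1] by auto
  then have "(\<lambda>x. u N x - v x) \<in> Lp_space 2 M"
    by (intro diff_L2[of 1 N]) (auto intro: less_imp_le)
  from L2_diff[OF u this, of N] have v_L2: "v \<in> Lp_space 2 M"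
    by simp
  moreover have "(\<lambda>n. L2_norm M (\<lambda>x. u n x - v x)) \<longlonglongrightarrow> 0"
  proof (rule LIMSEQ_I)
    fix e :: real assume "0 < e"
    then obtain N where N: "\<And>m n. N \<le> m \<Longrightarrow> N \<le> n \<Longrightarrow> L2_norm M (\<lambda>x. u m x - u n x) < e / 2"
      using Cauchy[of "e / 2"] by auto
    have "L2_norm M (\<lambda>x. u n x - v x) \<le> e / 2" if "N \<le> n" for n
      using N \<open>0 < e\<close> that by (intro diff_le[of "e / 2" N]) (auto intro: less_imp_le)
    then have "norm (L2_norm M (\<lambda>x. u n x - v x) - 0) < e" if "N \<le> n" for n
      using \<open>0 < e\<close> that by (fastforce intro: order_le_less_trans)
    then show "\<exists>N. \<forall>n\<ge>N. norm (L2_norm M (\<lambda>x. u n x - v x) - 0) < e"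
      by blast
  qed
  ultimately show ?thesis using that by blast
qed

section \<open>Bounded operators and orthogonal complements\<close>

text \<open>Finiteness of the infimum only requires one finite admissible constant, so a real bound
  \<open>K\<close> is available without knowing that the operator norm is attained.\<close>

lemma bounded_operator_2_iff:
  "bounded_operator 2 2 M T \<longleftrightarrow>
     T \<in> Lp_space 2 M \<rightarrow> Lp_space 2 M \<and>
     (\<forall>f \<in> Lp_space 2 M. \<forall>g \<in> Lp_space 2 M.
        (AE x in M. f x = g x) \<longrightarrow> (AE x in M. T f x = T g x)) \<and>
     (\<forall>f \<in> Lp_space 2 M. \<forall>g \<in> Lp_space 2 M.
        AE x in M. T (\<lambda>y. f y + g y) x = T f x + T g x) \<and>
     (\<forall>f \<in> Lp_space 2 M. \<forall>c. AE x in M. T (\<lambda>y. c * f y) x = c * T f x) \<and>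
     (\<exists>K\<ge>0. \<forall>f \<in> Lp_space 2 M. L2_norm M (T f) \<le> K * L2_norm M f)"
proof -
  have "op_norm 2 2 M T < \<infinity> \<longleftrightarrow> (\<exists>K\<ge>0. \<forall>f \<in> Lp_space 2 M. L2_norm M (T f) \<le> K * L2_norm M f)"
    if T: "T \<in> Lp_space 2 M \<rightarrow> Lp_space 2 M"
  proof -
    have *: "(\<forall>f \<in> Lp_space 2 M. Lp_norm 2 M (T f) \<le> ennreal K * Lp_norm 2 M f)
          \<longleftrightarrow> (\<forall>f \<in> Lp_space 2 M. L2_norm M (T f) \<le> K * L2_norm M f)" if "0 \<le> K" for K
    proof (rule ball_cong[OF refl])
      fix f assume f: "f \<in> Lp_space 2 M"
      moreover have "T f \<in> Lp_space 2 M" using f T by auto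
      ultimately show "Lp_norm 2 M (T f) \<le> ennreal K * Lp_norm 2 M f
                       \<longleftrightarrow> L2_norm M (T f) \<le> K * L2_norm M f"
        using that by (simp add: Lp_norm_2 flip: ennreal_mult)
    qed
    have "op_norm 2 2 M T < \<infinity>
          \<longleftrightarrow> (\<exists>C<\<infinity>. \<forall>f \<in> Lp_space 2 M. Lp_norm 2 M (T f) \<le> C * Lp_norm 2 M f)"
      unfolding op_norm_def Inf_less_iff by blast
    also have "\<dots> \<longleftrightarrow> (\<exists>K\<ge>0. \<forall>f \<in> Lp_space 2 M. L2_norm M (T f) \<le> K * L2_norm M f)"
    proof safe
      fix C :: ennreal
      assume "C < \<infinity>" and C: "\<forall>f\<in>Lp_space 2 M. Lp_norm 2 M (T f) \<le> C * Lp_norm 2 M f"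
      then obtain K where "0 \<le> K" "C = ennreal K"
        by (cases C) auto
      then show "\<exists>K\<ge>0. \<forall>f\<in>Lp_space 2 M. L2_norm M (T f) \<le> K * L2_norm M f"
        using C *[of K] by blast
    next
      fix K :: real
      assume "0 \<le> K" "\<forall>f\<in>Lp_space 2 M. L2_norm M (T f) \<le> K * L2_norm M f"
      then show "\<exists>C<\<infinity>. \<forall>f \<in> Lp_space 2 M. Lp_norm 2 M (T f) \<le> C * Lp_norm 2 M f"
        using *[of K] by (intro exI[of _ "ennreal K"]) simp
    qed
    finally show ?thesis .
  qed
  then show ?thesis
    unfolding bounded_operator_def by meson
qed

section \<open>Almost-everywhere calculus for a bounded operator on L^2\<close>

context
  fixes M :: "'a measure" and T :: "('a \<Rightarrow> real) \<Rightarrow> ('a \<Rightarrow> real)"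
  assumes T: "bounded_operator 2 2 M T"
begin

lemma operator_L2: "f \<in> Lp_space 2 M \<Longrightarrow> T f \<in> Lp_space 2 M"
  using T unfolding bounded_operator_2_iff by blast

lemma operator_cong:
  "f \<in> Lp_space 2 M \<Longrightarrow> g \<in> Lp_space 2 M \<Longrightarrow> AE x in M. f x = g x \<Longrightarrow> AE x in M. T f x = T g x"
  using T unfolding bounded_operator_2_iff by blast

lemma operator_add:
  "f \<in> Lp_space 2 M \<Longrightarrow> g \<in> Lp_space 2 M \<Longrightarrow> AE x in M. T (\<lambda>y. f y + g y) x = T f x + T g x"
  using T unfolding bounded_operator_2_iff by blast

lemma operator_scale:
  "f \<in> Lp_space 2 M \<Longrightarrow> AE x in M. T (\<lambda>y. c * f y) x = c * T f x"
  using T unfolding bounded_operator_2_iff by blast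

lemma operator_norm_bound:
  obtains K where "0 \<le> K" "\<And>f. f \<in> Lp_space 2 M \<Longrightarrow> L2_norm M (T f) \<le> K * L2_norm M f"
  using T unfolding bounded_operator_2_iff by blast

lemma operator_diff:
  assumes "f \<in> Lp_space 2 M" "g \<in> Lp_space 2 M"
  shows "AE x in M. T (\<lambda>y. f y - g y) x = T f x - T g x"
  using operator_add[OF assms(1) L2_scale[OF assms(2), of "-1"]] operator_scale[OF assms(2), of "-1"]
  by eventually_elim simp

lemma operator_zero:
  assumes "f \<in> Lp_space 2 M" "AE x in M. f x = 0"
  shows "AE x in M. T f x = 0"
  using operator_scale[OF assms(1), of 0] operator_cong[OF assms(1) L2_zero assms(2)]
  by eventually_elim simp

lemma operator_sum:
  assumes "finite F" "\<And>i. i \<in> F \<Longrightarrow> f i \<in> Lp_space 2 M"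
  shows "AE x in M. T (\<lambda>y. \<Sum>i\<in>F. f i y) x = (\<Sum>i\<in>F. T (f i) x)"
  using assms
proof (induction F rule: finite_induct)
  case empty
  show ?case using operator_zero[OF L2_zero] by simp
next
  case (insert j F)
  have "AE x in M. T (\<lambda>y. f j y + (\<Sum>i\<in>F. f i y)) x = T (f j) x + T (\<lambda>y. \<Sum>i\<in>F. f i y) x"
    using insert.prems by (intro operator_add L2_sum) auto
  moreover have "AE x in M. T (\<lambda>y. \<Sum>i\<in>F. f i y) x = (\<Sum>i\<in>F. T (f i) x)"
    using insert by blast
  ultimately show ?case
    by eventually_elim (use insert.hyps in simp)
qed

lemma bounded_operator_shift: "bounded_operator 2 2 M (\<lambda>f x. T f x - l * f x)"
  unfolding bounded_operator_2_iff
proof (intro conjI ballI allI impI)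
  show "(\<lambda>f x. T f x - l * f x) \<in> Lp_space 2 M \<rightarrow> Lp_space 2 M"
    by (auto intro!: L2_diff L2_scale operator_L2)
  obtain K where K: "0 \<le> K" "\<And>f. f \<in> Lp_space 2 M \<Longrightarrow> L2_norm M (T f) \<le> K * L2_norm M f"
    using operator_norm_bound by blast
  have "L2_norm M (\<lambda>x. T f x - l * f x) \<le> (K + \<bar>l\<bar>) * L2_norm M f" if "f \<in> Lp_space 2 M" for f
    using L2_norm_diff_le[OF operator_L2[OF that] L2_scale[OF that], of l] K(2)[OF that]
    by (simp add: L2_norm_scale distrib_right)
  then show "\<exists>K\<ge>0. \<forall>f\<in>Lp_space 2 M. L2_norm M (\<lambda>x. T f x - l * f x) \<le> K * L2_norm M f"
    using K(1) by (intro exI[of _ "K + \<bar>l\<bar>"]) auto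
next
  fix f g assume "f \<in> Lp_space 2 M" "g \<in> Lp_space 2 M"
  from operator_add[OF this]
  show "AE x in M. T (\<lambda>y. f y + g y) x - l * (f x + g x) = T f x - l * f x + (T g x - l * g x)"
    by eventually_elim (simp add: algebra_simps)
next
  fix f g assume *: "f \<in> Lp_space 2 M" "g \<in> Lp_space 2 M" "AE x in M. f x = g x"
  from operator_cong[OF *] *(3)
  show "AE x in M. T f x - l * f x = T g x - l * g x"
    by eventually_elim simp
next
  fix f c assume "f \<in> Lp_space 2 M"
  from operator_scale[OF this, of c]
  show "AE x in M. T (\<lambda>y. c * f y) x - l * (c * f x) = c * (T f x - l * f x)"
    by eventually_elim (simp add: algebra_simps)
qed

end

section \<open>Orthogonal complements and operators bounded below\<close>

definition orthocomplement :: "'a measure \<Rightarrow> ('a \<Rightarrow> real) set \<Rightarrow> ('a \<Rightarrow> real) set" where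
  "orthocomplement M S = {f \<in> Lp_space 2 M. \<forall>e \<in> S. L2_inner M f e = 0}"

definition orthonormal :: "'a measure \<Rightarrow> ('a \<Rightarrow> real) set \<Rightarrow> bool" where
  "orthonormal M F \<longleftrightarrow> (\<forall>e \<in> F. \<forall>e' \<in> F. L2_inner M e e' = (if e = e' then 1 else 0))"

text \<open>For Q - l in place of \<open>T\<close> this says that \<open>l\<close> is not an
  approximate eigenvalue on \<open>X\<close>. The constant \<open>c\<close> is common to all of
  \<open>X\<close>, which makes it stronger than injectivity.\<close>

definition bounded_below_on ::
  "'a measure \<Rightarrow> ('a \<Rightarrow> real) set \<Rightarrow> (('a \<Rightarrow> real) \<Rightarrow> ('a \<Rightarrow> real)) \<Rightarrow> bool" where
  "bounded_below_on M X T \<longleftrightarrow> (\<exists>c>0. \<forall>f\<in>X. c * L2_norm M f \<le> L2_norm M (T f))"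

lemma orthocomplement_L2: "f \<in> orthocomplement M S \<Longrightarrow> f \<in> Lp_space 2 M"
  by (simp add: orthocomplement_def)

lemma orthocomplement_scale:
  "f \<in> orthocomplement M S \<Longrightarrow> (\<lambda>x. c * f x) \<in> orthocomplement M S"
  by (simp add: orthocomplement_def L2_scale L2_inner_scale_left)

lemma orthocomplement_add:
  "S \<subseteq> Lp_space 2 M \<Longrightarrow> f \<in> orthocomplement M S \<Longrightarrow> g \<in> orthocomplement M S \<Longrightarrow>
    (\<lambda>x. f x + g x) \<in> orthocomplement M S"
  by (auto simp: orthocomplement_def L2_add L2_inner_add_left subset_iff)

lemma orthocomplement_diff:
  "S \<subseteq> Lp_space 2 M \<Longrightarrow> f \<in> orthocomplement M S \<Longrightarrow> g \<in> orthocomplement M S \<Longrightarrow>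
    (\<lambda>x. f x - g x) \<in> orthocomplement M S"
  by (auto simp: orthocomplement_def L2_diff L2_inner_diff_left subset_iff)

lemma orthocomplement_insert:
  "orthocomplement M (insert e S) = {f \<in> orthocomplement M S. L2_inner M f e = 0}"
  by (auto simp: orthocomplement_def)

lemma L2_norm_orthonormal: "orthonormal M F \<Longrightarrow> e \<in> F \<Longrightarrow> L2_norm M e = 1"
  by (simp add: orthonormal_def L2_norm_def)

lemma orthonormal_subset: "orthonormal M F \<Longrightarrow> G \<subseteq> F \<Longrightarrow> orthonormal M G"
  unfolding orthonormal_def by blast

text \<open>Continuity of the inner product. With the completeness of L^2 it lets orthogonal
  complements serve as the closed subspaces of the argument: \<open>S\<close> empty gives all of
  L^2, and enlarging \<open>S\<close> removes directions.\<close>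

lemma orthocomplement_closed:
  assumes S: "S \<subseteq> Lp_space 2 M" and u: "\<And>n::nat. u n \<in> orthocomplement M S"
    and v: "v \<in> Lp_space 2 M" and lim: "(\<lambda>n. L2_norm M (\<lambda>x. u n x - v x)) \<longlonglongrightarrow> 0"
  shows "v \<in> orthocomplement M S"
  unfolding orthocomplement_def
proof (intro CollectI conjI ballI v)
  fix e assume "e \<in> S"
  then have e: "e \<in> Lp_space 2 M" using S by auto
  have "\<bar>L2_inner M v e\<bar> \<le> L2_norm M (\<lambda>x. u n x - v x) * L2_norm M e" for n
    using L2_Cauchy_Schwarz[OF L2_diff[OF orthocomplement_L2[OF u] v] e, of n]
      L2_inner_diff_left[OF orthocomplement_L2[OF u] v e, of n] u[of n] \<open>e \<in> S\<close>
    by (simp add: orthocomplement_def)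
  moreover have "(\<lambda>n. L2_norm M (\<lambda>x. u n x - v x) * L2_norm M e) \<longlonglongrightarrow> 0 * L2_norm M e"
    by (intro tendsto_intros lim)
  ultimately have "\<bar>L2_inner M v e\<bar> \<le> 0 * L2_norm M e"
    by (intro LIMSEQ_le_const) auto
  then show "L2_inner M v e = 0" by simp
qed

text \<open>Closedness of the image of a closed subspace under an operator bounded below, in the
  form of an attained distance. Along a minimising sequence the parallelogram law makes the images
  \<open>T (u n)\<close> Cauchy, and the lower bound carries this over to the u_n, whose limit stays
  in the complement.\<close>

lemma (in sigma_finite_measure) nearest_point_of_range:
  assumes T: "bounded_operator 2 2 M T" and S: "S \<subseteq> Lp_space 2 M"
    and below: "bounded_below_on M (orthocomplement M S) T" and f: "f \<in> Lp_space 2 M"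
  obtains y where "y \<in> orthocomplement M S"
    "\<And>z. z \<in> orthocomplement M S \<Longrightarrow>
      L2_norm M (\<lambda>x. T y x - f x) \<le> L2_norm M (\<lambda>x. T z x - f x)"
proof -
  let ?X = "orthocomplement M S"
  obtain c where "0 < c" and c: "\<And>y. y \<in> ?X \<Longrightarrow> c * L2_norm M y \<le> L2_norm M (T y)"
    using below unfolding bounded_below_on_def by blast
  obtain K where "0 \<le> K" and K: "\<And>y. y \<in> Lp_space 2 M \<Longrightarrow> L2_norm M (T y) \<le> K * L2_norm M y"
    using operator_norm_bound[OF T] by blast
  define D where "D = (\<lambda>z. (L2_norm M (\<lambda>x. T z x - f x))\<^sup>2)"
  define d where "d = (INF z\<in>?X. D z)"
  have "(\<lambda>x. 0) \<in> ?X" by (simp add: orthocomplement_def L2_zero)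
  then have "?X \<noteq> {}" by blast
  have bdd: "bdd_below (D ` ?X)"
    by (rule bdd_belowI2[of _ 0]) (simp add: D_def)
  have d_le: "d \<le> D z" if "z \<in> ?X" for z
    unfolding d_def using bdd that by (rule cINF_lower)
  have "\<exists>z\<in>?X. D z < d + inverse (real (Suc n))" for n
    using \<open>?X \<noteq> {}\<close> bdd cINF_less_iff[of ?X D "d + inverse (real (Suc n))"] by (simp add: d_def)
  then obtain u where u: "\<And>n. u n \<in> ?X" and Du: "\<And>n. D (u n) < d + inverse (real (Suc n))"
    by metis
  note u_L2 = orthocomplement_L2[OF u]
  \<comment> \<open>Midpoints are admissible, so \<open>D\<close> at a midpoint is at least
    \<open>d\<close>; subtracting 4 d from 2 D(u_m) + 2 D(u_n) leaves only the two excesses over the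
    infimum.\<close>
  have mid: "c\<^sup>2 * (L2_norm M (\<lambda>x. u m x - u n x))\<^sup>2
        \<le> 2 * inverse (real (Suc m)) + 2 * inverse (real (Suc n))" for m n
  proof -
    let ?s = "\<lambda>x. u m x + u n x" and ?h = "\<lambda>x. (1/2) * (u m x + u n x)"
    have h: "?h \<in> ?X" and s: "?s \<in> Lp_space 2 M"
      using orthocomplement_scale[OF orthocomplement_add[OF S u[of m] u[of n]], of "1/2"]
        L2_add[OF u_L2 u_L2] by auto
    let ?a = "\<lambda>x. T (u m) x - f x" and ?b = "\<lambda>x. T (u n) x - f x"
    have ab: "?a \<in> Lp_space 2 M" "?b \<in> Lp_space 2 M"
      by (auto intro!: L2_diff f operator_L2[OF T] u_L2)
    have "AE x in M. ?a x + ?b x = 2 * (T ?h x - f x)"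
      using operator_scale[OF T s, of "1/2"] operator_add[OF T u_L2[of m] u_L2[of n]]
      by eventually_elim (simp add: algebra_simps)
    then have "L2_norm M (\<lambda>x. ?a x + ?b x) = L2_norm M (\<lambda>x. 2 * (T ?h x - f x))"
      by (intro L2_norm_cong_AE L2_add ab L2_scale L2_diff operator_L2[OF T] f
          orthocomplement_L2[OF h])
    then have sum: "(L2_norm M (\<lambda>x. ?a x + ?b x))\<^sup>2 = 4 * D ?h"
      by (simp only: L2_norm_scale D_def power_mult_distrib) simp
    have "AE x in M. T (\<lambda>x. u m x - u n x) x = ?a x - ?b x"
      using operator_diff[OF T u_L2[of m] u_L2[of n]] by eventually_elim simp
    then have "L2_norm M (T (\<lambda>x. u m x - u n x)) = L2_norm M (\<lambda>x. ?a x - ?b x)"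
      by (intro L2_norm_cong_AE L2_diff[OF ab] operator_L2[OF T] L2_diff[OF u_L2 u_L2])
    then have "(L2_norm M (T (\<lambda>x. u m x - u n x)))\<^sup>2 = 2 * D (u m) + 2 * D (u n) - 4 * D ?h"
      using L2_parallelogram[OF ab] sum by (simp add: D_def)
    also have "\<dots> \<le> 2 * inverse (real (Suc m)) + 2 * inverse (real (Suc n))"
      using Du[of m] Du[of n] d_le[OF h] by linarith
    finally have "(L2_norm M (T (\<lambda>x. u m x - u n x)))\<^sup>2 \<le> \<dots>" .
    moreover have "(c * L2_norm M (\<lambda>x. u m x - u n x))\<^sup>2
                   \<le> (L2_norm M (T (\<lambda>x. u m x - u n x)))\<^sup>2"
      using c[OF orthocomplement_diff[OF S u u], of m n] \<open>0 < c\<close> by (intro power_mono) auto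
    ultimately show ?thesis by (simp add: power_mult_distrib)
  qed
  have "\<exists>N. \<forall>m\<ge>N. \<forall>n\<ge>N. L2_norm M (\<lambda>x. u m x - u n x) < e" if "0 < e" for e
  proof -
    \<comment> \<open>Each of the two terms 2 / (m + 1) and 2 / (n + 1) has to stay below half of
      c^2 e^2.\<close>
    have "0 < c\<^sup>2 * e\<^sup>2 / 4" using that \<open>0 < c\<close> by simp
    then obtain N where N: "inverse (real (Suc N)) < c\<^sup>2 * e\<^sup>2 / 4"
      using reals_Archimedean by blast
    have "L2_norm M (\<lambda>x. u m x - u n x) < e" if "N \<le> m" "N \<le> n" for m n
    proof -
      have "inverse (real (Suc m)) \<le> inverse (real (Suc N))"
        "inverse (real (Suc n)) \<le> inverse (real (Suc N))"
        using that by (auto intro!: le_imp_inverse_le)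
      then have "c\<^sup>2 * (L2_norm M (\<lambda>x. u m x - u n x))\<^sup>2 < c\<^sup>2 * e\<^sup>2"
        using mid[of m n] N by linarith
      then have "(L2_norm M (\<lambda>x. u m x - u n x))\<^sup>2 < e\<^sup>2"
        using \<open>0 < c\<close> by simp
      then show ?thesis using \<open>0 < e\<close> by (simp add: power_less_imp_less_base)
    qed
    then show ?thesis by blast
  qed
  then obtain y where y: "y \<in> Lp_space 2 M" and lim: "(\<lambda>n. L2_norm M (\<lambda>x. u n x - y x)) \<longlonglongrightarrow> 0"
    using L2_complete[of u] u_L2 by blast
  have yX: "y \<in> ?X" using orthocomplement_closed[OF S u y lim] .
  let ?Ny = "L2_norm M (\<lambda>x. T y x - f x)"
  have "?Ny \<le> sqrt (d + inverse (real (Suc n))) + K * L2_norm M (\<lambda>x. u n x - y x)" for n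
  proof -
    let ?a = "\<lambda>x. T (u n) x - f x" and ?b = "\<lambda>x. T y x - f x"
    have ab: "?a \<in> Lp_space 2 M" "?b \<in> Lp_space 2 M"
      by (auto intro!: L2_diff f operator_L2[OF T] u_L2 y)
    have "AE x in M. T (\<lambda>x. u n x - y x) x = ?a x - ?b x"
      using operator_diff[OF T u_L2[of n] y] by eventually_elim simp
    then have "L2_norm M (T (\<lambda>x. u n x - y x)) = L2_norm M (\<lambda>x. ?a x - ?b x)"
      by (intro L2_norm_cong_AE L2_diff[OF ab] operator_L2[OF T] L2_diff[OF u_L2 y])
    moreover have "?Ny \<le> L2_norm M (\<lambda>x. ?a x - ?b x) + L2_norm M ?a"
      using L2_norm_triangle_diff[OF ab(2,1)] L2_norm_minus_commute[of M ?a ?b] by simp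
    moreover have "L2_norm M ?a \<le> sqrt (d + inverse (real (Suc n)))"
      using Du[of n] by (intro real_le_rsqrt) (simp add: D_def)
    ultimately show ?thesis using K[OF L2_diff[OF u_L2 y], of n] by linarith
  qed
  moreover have "(\<lambda>n. sqrt (d + inverse (real (Suc n))) + K * L2_norm M (\<lambda>x. u n x - y x))
        \<longlonglongrightarrow> sqrt (d + 0) + K * 0"
    by (intro tendsto_intros lim LIMSEQ_inverse_real_of_nat)
  ultimately have "?Ny \<le> sqrt (d + 0) + K * 0"
    by (intro LIMSEQ_le_const) auto
  then have Ny: "?Ny \<le> sqrt d" by simp
  show ?thesis
  proof (rule that[OF yX])
    fix z assume "z \<in> ?X"
    then have "sqrt d \<le> L2_norm M (\<lambda>x. T z x - f x)"
      using d_le[of z] by (intro real_le_lsqrt) (auto simp: D_def)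
    with Ny show "?Ny \<le> L2_norm M (\<lambda>x. T z x - f x)" by simp
  qed
qed

text \<open>The image of the smaller complement is closed, so \<open>T e\<close> has an attained
  distance \<open>d\<close> from it, and injectivity on the larger complement makes \<open>d\<close>
  positive. For f = a e + y this controls the coefficient by |a| d \<le> ||T f||, after which the
  given lower bound controls y.\<close>

lemma (in sigma_finite_measure) bounded_below_on_extend:
  assumes T: "bounded_operator 2 2 M T" and S: "S \<subseteq> Lp_space 2 M"
    and inj: "\<And>y. y \<in> orthocomplement M S \<Longrightarrow> L2_norm M (T y) = 0 \<Longrightarrow> L2_norm M y = 0"
    and e: "e \<in> orthocomplement M S" "L2_norm M e = 1"
    and below: "bounded_below_on M (orthocomplement M (insert e S)) T"
  shows "bounded_below_on M (orthocomplement M S) T"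
proof -
  let ?X = "orthocomplement M S" and ?Y = "orthocomplement M (insert e S)"
  note eL2 = orthocomplement_L2[OF e(1)]
  have ee: "L2_inner M e e = 1" using e(2) by (simp add: L2_norm_def)
  obtain c where "0 < c" and c: "\<And>y. y \<in> ?Y \<Longrightarrow> c * L2_norm M y \<le> L2_norm M (T y)"
    using below unfolding bounded_below_on_def by blast
  have eS: "insert e S \<subseteq> Lp_space 2 M" using S eL2 by auto
  obtain p where p: "p \<in> ?Y"
    and p_min: "\<And>z. z \<in> ?Y \<Longrightarrow>
      L2_norm M (\<lambda>x. T p x - T e x) \<le> L2_norm M (\<lambda>x. T z x - T e x)"
    using nearest_point_of_range[OF T eS below operator_L2[OF T eL2]] by blast
  define d where "d = L2_norm M (\<lambda>x. T p x - T e x)"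
  have pX: "p \<in> ?X" and pe: "L2_inner M p e = 0" and pL2: "p \<in> Lp_space 2 M"
    using p by (auto simp: orthocomplement_insert orthocomplement_L2)
  \<comment> \<open>Distance 0 would force p = e almost everywhere, although \<open>p\<close> is
    orthogonal to the unit vector \<open>e\<close>: ||p - e||^2 = ||p||^2 + 1.\<close>
  have "d \<noteq> 0"
  proof
    assume "d = 0"
    have "AE x in M. T (\<lambda>x. p x - e x) x = T p x - T e x"
      by (rule operator_diff[OF T pL2 eL2])
    then have "L2_norm M (T (\<lambda>x. p x - e x)) = d"
      unfolding d_def by (intro L2_norm_cong_AE L2_diff operator_L2[OF T] pL2 eL2)
    then have "L2_norm M (\<lambda>x. p x - e x) = 0"
      using \<open>d = 0\<close> inj[OF orthocomplement_diff[OF S pX e(1)]] by simp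
    then have "(L2_norm M p)\<^sup>2 + 1 = 0"
      using L2_norm_diff_sq[OF pL2 eL2] pe e(2) by simp
    then show False
      using zero_le_power2[of "L2_norm M p"] by linarith
  qed
  then have "0 < d" by (simp add: d_def order_less_le)
  have key: "L2_norm M f \<le> (1 / d + (1 + L2_norm M (T e) / d) / c) * L2_norm M (T f)"
    if f: "f \<in> ?X" for f
  proof -
    note fL2 = orthocomplement_L2[OF f]
    define a where "a = L2_inner M f e"
    define y where "y = (\<lambda>x. f x - a * e x)"
    have yX: "y \<in> ?X"
      unfolding y_def by (intro orthocomplement_diff[OF S] f orthocomplement_scale e)
    moreover have "L2_inner M y e = 0"
      unfolding y_def
      using L2_inner_diff_left[OF fL2 L2_scale[OF eL2] eL2] ee by (simp add: L2_inner_scale_left a_def)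
    ultimately have y: "y \<in> ?Y" by (simp add: orthocomplement_insert)
    note yL2 = orthocomplement_L2[OF y]
    have Tf: "AE x in M. T f x = a * T e x + T y x"
      using operator_diff[OF T fL2 L2_scale[OF eL2, of a]] operator_scale[OF T eL2, of a]
      unfolding y_def by eventually_elim simp
    have "\<bar>a\<bar> * d \<le> L2_norm M (T f)"
    proof (cases "a = 0")
      case False
      \<comment> \<open>With z = -y / a one has T f = -a (T z - T e), so the minimality of
        \<open>p\<close> can be applied to z.\<close>
      have z: "(\<lambda>x. (- 1 / a) * y x) \<in> ?Y" using orthocomplement_scale[OF y] .
      have "AE x in M. T f x = (- a) * (T (\<lambda>x. (- 1 / a) * y x) x - T e x)"
        using Tf operator_scale[OF T yL2, of "- 1 / a"]
        by eventually_elim (use False in \<open>simp add: algebra_simps\<close>)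
      then have "L2_norm M (T f)
          = L2_norm M (\<lambda>x. (- a) * (T (\<lambda>x. (- 1 / a) * y x) x - T e x))"
        by (intro L2_norm_cong_AE L2_scale L2_diff operator_L2[OF T] fL2 eL2
            orthocomplement_L2[OF z])
      also have "\<dots> = \<bar>a\<bar> * L2_norm M (\<lambda>x. T (\<lambda>x. (- 1 / a) * y x) x - T e x)"
        by (simp only: L2_norm_scale) simp
      finally show ?thesis
        using mult_left_mono[OF p_min[OF z], of "\<bar>a\<bar>"] by (simp add: d_def)
    qed simp
    then have a_le: "\<bar>a\<bar> \<le> L2_norm M (T f) / d"
      using \<open>0 < d\<close> by (simp add: pos_le_divide_eq)
    have "AE x in M. T y x = T f x - a * T e x"
      using Tf by eventually_elim simp
    then have "L2_norm M (T y) = L2_norm M (\<lambda>x. T f x - a * T e x)"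
      by (intro L2_norm_cong_AE L2_scale L2_diff operator_L2[OF T] fL2 eL2 yL2)
    also have "\<dots> \<le> L2_norm M (T f) + \<bar>a\<bar> * L2_norm M (T e)"
      using L2_norm_diff_le[OF operator_L2[OF T fL2] L2_scale[OF operator_L2[OF T eL2]], of a]
      by (simp add: L2_norm_scale)
    also have "\<dots> \<le> L2_norm M (T f) + L2_norm M (T f) / d * L2_norm M (T e)"
      by (intro add_left_mono mult_right_mono a_le) simp
    finally have "c * L2_norm M y \<le> (1 + L2_norm M (T e) / d) * L2_norm M (T f)"
      using c[OF y] by (simp add: algebra_simps)
    then have y_le: "L2_norm M y \<le> (1 + L2_norm M (T e) / d) / c * L2_norm M (T f)"
      using \<open>0 < c\<close> by (simp add: pos_le_divide_eq mult.commute)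
    have "L2_norm M f \<le> L2_norm M y + L2_norm M (\<lambda>x. a * e x)"
      using L2_norm_triangle_diff[OF fL2 L2_scale[OF eL2, of a]] by (simp add: y_def)
    also have "\<dots> = L2_norm M y + \<bar>a\<bar>" by (simp add: L2_norm_scale e)
    finally show ?thesis using y_le a_le by (simp add: algebra_simps)
  qed
  define C where "C = 1 / d + (1 + L2_norm M (T e) / d) / c"
  have "0 < C"
    unfolding C_def using \<open>0 < c\<close> \<open>0 < d\<close> by (intro add_pos_nonneg) auto
  with key have "1 / C * L2_norm M f \<le> L2_norm M (T f)" if "f \<in> ?X" for f
    using that by (simp add: C_def[symmetric] pos_divide_le_eq mult.commute)
  then show ?thesis
    unfolding bounded_below_on_def using \<open>0 < C\<close> by (intro exI[of _ "1 / C"]) auto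
qed

text \<open>\<open>S\<close> varies in the induction: a vector moves from \<open>F\<close> to
  \<open>S\<close> for the induction hypothesis and is removed from \<open>S\<close> again by the
  one-dimensional step. Orthonormality keeps the rest of \<open>F\<close> inside the smaller
  complement, and injectivity is inherited there.\<close>

lemma (in sigma_finite_measure) bounded_below_on_extend_finite:
  assumes T: "bounded_operator 2 2 M T" and "finite F"
    and "S \<subseteq> Lp_space 2 M"
    and "\<And>y. y \<in> orthocomplement M S \<Longrightarrow> L2_norm M (T y) = 0 \<Longrightarrow> L2_norm M y = 0"
    and "F \<subseteq> orthocomplement M S" "orthonormal M F"
    and "bounded_below_on M (orthocomplement M (S \<union> F)) T"
  shows "bounded_below_on M (orthocomplement M S) T"
  using assms(2-)
proof (induction F arbitrary: S rule: finite_induct)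
  case empty
  then show ?case by simp
next
  case (insert e F)
  have e: "e \<in> orthocomplement M S" "L2_norm M e = 1"
    using insert.prems(3) L2_norm_orthonormal[OF insert.prems(4), of e] by auto
  have "bounded_below_on M (orthocomplement M (insert e S)) T"
  proof (rule insert.IH)
    show "insert e S \<subseteq> Lp_space 2 M"
      using insert.prems orthocomplement_L2 by blast
    show "L2_norm M y = 0"
      if "y \<in> orthocomplement M (insert e S)" "L2_norm M (T y) = 0" for y
      using that insert.prems(2) by (simp add: orthocomplement_insert)
    show "F \<subseteq> orthocomplement M (insert e S)"
      using insert.prems(3,4) insert.hyps(2)
      by (auto simp: orthocomplement_insert orthonormal_def)
    show "orthonormal M F"
      using insert.prems(4) by (rule orthonormal_subset) auto
    show "bounded_below_on M (orthocomplement M (insert e S \<union> F)) T"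
      using insert.prems(5) by simp
  qed
  with bounded_below_on_extend[OF T insert.prems(1,2) e] show ?case by blast
qed

section \<open>Spectral theory of symmetric operators with bounded trace\<close>

lemma orthonormal_basis_iff:
  "orthonormal_basis M W B \<longleftrightarrow>
     B \<subseteq> W \<and> orthonormal M B \<and>
     (\<forall>f \<in> W. (\<forall>e \<in> B. L2_inner M f e = 0) \<longrightarrow> (AE x in M. f x = 0))"
  by (simp add: orthonormal_basis_def orthonormal_def)

lemma orthonormal_insert:
  assumes "orthonormal M F" "\<And>e. e \<in> F \<Longrightarrow> L2_inner M u e = 0" "L2_inner M u u = 1"
  shows "orthonormal M (insert u F)" "u \<notin> F"
proof -
  show "u \<notin> F" using assms(2,3) by auto
  have "L2_inner M e u = 0" if "e \<in> F" for e
    using assms(2)[OF that] by (simp only: L2_inner_commute[of M e u])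
  then show "orthonormal M (insert u F)"
    using assms \<open>u \<notin> F\<close> unfolding orthonormal_def by auto
qed

lemma L2_inner_normalize:
  assumes "L2_norm M f \<noteq> 0"
  shows "L2_inner M (\<lambda>x. inverse (L2_norm M f) * f x) (\<lambda>x. inverse (L2_norm M f) * f x) = 1"
  using assms
  by (simp only: L2_inner_scale_left L2_inner_scale_right L2_norm_sq[symmetric])
     (simp add: power2_eq_square field_simps)

lemma operator_norm_scale:
  assumes "bounded_operator 2 2 M T" "f \<in> Lp_space 2 M"
  shows "L2_norm M (T (\<lambda>x. c * f x)) = \<bar>c\<bar> * L2_norm M (T f)"
proof -
  have "L2_norm M (T (\<lambda>x. c * f x)) = L2_norm M (\<lambda>x. c * T f x)"
    using assms by (intro L2_norm_cong_AE operator_L2[OF assms(1)] L2_scale operator_scale)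
  then show ?thesis by (simp add: L2_norm_scale)
qed

text \<open>Zorn's lemma, since L^2 may be nonseparable. A maximal orthonormal system in
  \<open>W\<close> is complete: a vector of nonzero norm orthogonal to it could be normalised and
  adjoined, and normalising stays in \<open>W\<close> by the closure under scaling.\<close>

lemma exists_orthonormal_basis:
  assumes L2: "W \<subseteq> Lp_space 2 M" and scale: "\<And>f c. f \<in> W \<Longrightarrow> (\<lambda>x. c * f x) \<in> W"
  shows "\<exists>B. orthonormal_basis M W B"
proof -
  have "\<Union>\<C> \<in> {B. B \<subseteq> W \<and> orthonormal M B}"
    if "subset.chain {B. B \<subseteq> W \<and> orthonormal M B} \<C>" for \<C>
  proof -
    have *: "\<And>X. X \<in> \<C> \<Longrightarrow> X \<subseteq> W \<and> orthonormal M X"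
      and tot: "\<And>X Y. X \<in> \<C> \<Longrightarrow> Y \<in> \<C> \<Longrightarrow> X \<subseteq> Y \<or> Y \<subseteq> X"
      using that unfolding subset.chain_def by blast+
    have "L2_inner M e e' = (if e = e' then 1 else 0)" if ee: "e \<in> \<Union>\<C>" "e' \<in> \<Union>\<C>" for e e'
    proof -
      obtain X Y where XY: "X \<in> \<C>" "Y \<in> \<C>" "e \<in> X" "e' \<in> Y" using ee by blast
      then obtain Z where "Z \<in> \<C>" "e \<in> Z" "e' \<in> Z"
        using tot[OF XY(1,2)] by blast
      with *[of Z] show ?thesis unfolding orthonormal_def by blast
    qed
    with * show ?thesis by (auto simp: orthonormal_def)
  qed
  then obtain B where B: "B \<subseteq> W" "orthonormal M B"
    and max: "\<And>X. X \<subseteq> W \<Longrightarrow> orthonormal M X \<Longrightarrow> B \<subseteq> X \<Longrightarrow> X = B"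
    using subset_Zorn'[of "{B. B \<subseteq> W \<and> orthonormal M B}"] by auto
  have "AE x in M. f x = 0" if f: "f \<in> W" and perp: "\<And>e. e \<in> B \<Longrightarrow> L2_inner M f e = 0" for f
  proof (rule ccontr)
    assume "\<not> (AE x in M. f x = 0)"
    then have nz: "L2_norm M f \<noteq> 0"
      using L2_norm_eq_0_iff f L2 by blast
    let ?u = "\<lambda>x. inverse (L2_norm M f) * f x"
    have "L2_inner M ?u ?u = 1"
      using nz by (rule L2_inner_normalize)
    moreover have "L2_inner M ?u e = 0" if "e \<in> B" for e
      using perp[OF that] by (simp add: L2_inner_scale_left)
    ultimately have "orthonormal M (insert ?u B)" "?u \<notin> B"
      using orthonormal_insert[OF B(2)] by auto
    then show False
      using max[of "insert ?u B"] scale[OF f] B(1) by blast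
  qed
  with B show ?thesis unfolding orthonormal_basis_iff by blast
qed

section \<open>Eigenspaces of a bounded operator\<close>

lemma eigenspace_scale:
  assumes "bounded_operator 2 2 M T" "f \<in> eigenspace M T l"
  shows "(\<lambda>x. c * f x) \<in> eigenspace M T l"
proof -
  have "f \<in> Lp_space 2 M" and eig: "AE x in M. T f x = l * f x"
    using assms by (auto simp: eigenspace_def)
  moreover from operator_scale[OF assms(1) this(1), of c] eig
  have "AE x in M. T (\<lambda>x. c * f x) x = l * (c * f x)"
    by eventually_elim simp
  ultimately show ?thesis by (simp add: eigenspace_def L2_scale)
qed

lemma eigenspace_L2: "f \<in> eigenspace M T l \<Longrightarrow> f \<in> Lp_space 2 M"
  by (simp add: eigenspace_def)

lemma eigenspace_norm:
  assumes "bounded_operator 2 2 M T" "f \<in> eigenspace M T l"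
  shows "L2_norm M (T f) = \<bar>l\<bar> * L2_norm M f"
proof -
  have "f \<in> Lp_space 2 M" "AE x in M. T f x = l * f x"
    using assms(2) by (auto simp: eigenspace_def)
  then have "L2_norm M (T f) = L2_norm M (\<lambda>x. l * f x)"
    by (intro L2_norm_cong_AE operator_L2[OF assms(1)] L2_scale)
  then show ?thesis by (simp add: L2_norm_scale)
qed

lemma eigenspace_iff_norm:
  assumes "bounded_operator 2 2 M T" "f \<in> Lp_space 2 M"
  shows "f \<in> eigenspace M T l \<longleftrightarrow> L2_norm M (\<lambda>x. T f x - l * f x) = 0"
  using L2_norm_eq_0_iff[OF operator_L2[OF bounded_operator_shift[OF assms(1), of l] assms(2)]] assms(2)
  by (simp add: eigenspace_def)

text \<open>A basis-free form of the Hilbert-Schmidt condition: \<open>C\<close> bounds the sums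
  over all finite orthonormal families. It is all that the spectral theory takes from the
  weight.\<close>

locale symmetric_trace_bounded = sigma_finite_measure M for M :: "'a measure" +
  fixes Q :: "('a \<Rightarrow> real) \<Rightarrow> ('a \<Rightarrow> real)" and C :: real
  assumes bounded: "bounded_operator 2 2 M Q"
    and symmetric: "symmetric_operator M Q"
    and trace_bound: "\<And>F. finite F \<Longrightarrow> F \<subseteq> Lp_space 2 M \<Longrightarrow> orthonormal M F \<Longrightarrow>
      (\<Sum>e\<in>F. (L2_norm M (Q e))\<^sup>2) \<le> C"
begin

lemma inner_symmetric:
  "f \<in> Lp_space 2 M \<Longrightarrow> g \<in> Lp_space 2 M \<Longrightarrow> L2_inner M (Q f) g = L2_inner M f (Q g)"
  using symmetric by (simp add: symmetric_operator_def)

text \<open>Choose \<open>F\<close> with a sum within \<delta>^2 of the supremum. Adjoining a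
  further unit vector e raises the sum by ||Q e||^2 and cannot pass the supremum, so ||Q e|| \<le>
  \<delta>. The families are confined to the complement of \<open>S\<close> so that their members
  can be restored to it one by one.\<close>

lemma finite_rank_approximation:
  assumes S: "S \<subseteq> Lp_space 2 M" and "0 < \<delta>"
  obtains F where "finite F" "F \<subseteq> orthocomplement M S" "orthonormal M F"
    "\<And>u. u \<in> orthocomplement M (S \<union> F) \<Longrightarrow> L2_norm M (Q u) \<le> \<delta> * L2_norm M u"
proof -
  define \<F> where "\<F> = {F. finite F \<and> F \<subseteq> orthocomplement M S \<and> orthonormal M F}"
  define tr where "tr F = (\<Sum>e\<in>F. (L2_norm M (Q e))\<^sup>2)" for F
  have "tr F \<le> C" if "F \<in> \<F>" for F
    using that orthocomplement_L2[of _ M S] unfolding tr_def \<F>_def by (intro trace_bound) auto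
  then have bdd: "bdd_above (tr ` \<F>)" by (intro bdd_aboveI2)
  have "{} \<in> \<F>" by (simp add: \<F>_def orthonormal_def)
  then have "\<F> \<noteq> {}" by blast
  then have "\<exists>F\<in>\<F>. (SUP F\<in>\<F>. tr F) - \<delta>\<^sup>2 < tr F"
    using bdd less_cSUP_iff[of \<F> tr "(SUP F\<in>\<F>. tr F) - \<delta>\<^sup>2"] \<open>0 < \<delta>\<close> by simp
  then obtain F where F: "F \<in> \<F>" and trF: "(SUP F\<in>\<F>. tr F) - \<delta>\<^sup>2 < tr F" by blast
  have "L2_norm M (Q u) \<le> \<delta> * L2_norm M u" if u: "u \<in> orthocomplement M (S \<union> F)" for u
  proof (cases "L2_norm M u = 0")
    case True
    obtain K where "L2_norm M (Q u) \<le> K * L2_norm M u"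
      using operator_norm_bound[OF bounded] orthocomplement_L2[OF u] by metis
    with True show ?thesis by simp
  next
    case False
    let ?e = "\<lambda>x. inverse (L2_norm M u) * u x"
    have e: "?e \<in> orthocomplement M (S \<union> F)" by (rule orthocomplement_scale[OF u])
    have "L2_inner M ?e ?e = 1"
      using False by (rule L2_inner_normalize)
    moreover have "L2_inner M ?e f = 0" if "f \<in> F" for f
      using e that by (simp add: orthocomplement_def)
    ultimately have ins: "orthonormal M (insert ?e F)" "?e \<notin> F"
      using orthonormal_insert F by (auto simp: \<F>_def)
    then have "insert ?e F \<in> \<F>"
      using F e by (auto simp: \<F>_def orthocomplement_def)
    then have "tr (insert ?e F) \<le> (SUP F\<in>\<F>. tr F)"
      using bdd by (rule cSUP_upper)
    then have "(L2_norm M (Q ?e))\<^sup>2 \<le> \<delta>\<^sup>2"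
      using trF ins(2) F by (simp add: tr_def \<F>_def)
    then have "L2_norm M (Q ?e) \<le> \<delta>"
      using \<open>0 < \<delta>\<close> by (simp add: power2_le_iff_abs_le)
    then have "inverse (L2_norm M u) * L2_norm M (Q u) \<le> \<delta>"
      by (simp add: operator_norm_scale[OF bounded orthocomplement_L2[OF u]])
    then show ?thesis
      using False L2_norm_ge_0[of M u] by (simp add: field_simps order_less_le)
  qed
  with F show ?thesis using that by (auto simp: \<F>_def)
qed

lemma bounded_below_if_no_eigenvector:
  assumes S: "S \<subseteq> Lp_space 2 M" and "l \<noteq> 0"
    and no_eig: "\<And>u. u \<in> orthocomplement M S \<Longrightarrow> u \<in> eigenspace M Q l \<Longrightarrow> L2_norm M u = 0"
  shows "bounded_below_on M (orthocomplement M S) (\<lambda>f x. Q f x - l * f x)"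
proof -
  \<comment> \<open>With \<delta> = |l| / 2 the term l u outweighs Q u on the complement of S
    \<union> F and leaves ||(Q - l) u|| \<ge> |l| ||u|| / 2 there.\<close>
  have "0 < \<bar>l\<bar> / 2" using \<open>l \<noteq> 0\<close> by simp
  with S obtain F where F: "finite F" "F \<subseteq> orthocomplement M S" "orthonormal M F"
    and small: "\<And>u. u \<in> orthocomplement M (S \<union> F) \<Longrightarrow>
      L2_norm M (Q u) \<le> \<bar>l\<bar> / 2 * L2_norm M u"
    using finite_rank_approximation by metis
  have "\<bar>l\<bar> / 2 * L2_norm M u \<le> L2_norm M (\<lambda>x. Q u x - l * u x)"
    if u: "u \<in> orthocomplement M (S \<union> F)" for u
  proof -
    note uL2 = orthocomplement_L2[OF u]
    have "L2_norm M (\<lambda>x. l * u x) \<le> L2_norm M (\<lambda>x. l * u x - Q u x) + L2_norm M (Q u)"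
      by (intro L2_norm_triangle_diff L2_scale operator_L2[OF bounded] uL2)
    then show ?thesis
      using small[OF u] L2_norm_minus_commute[of M "\<lambda>x. l * u x" "Q u"] by (simp add: L2_norm_scale)
  qed
  then have "bounded_below_on M (orthocomplement M (S \<union> F)) (\<lambda>f x. Q f x - l * f x)"
    unfolding bounded_below_on_def using \<open>0 < \<bar>l\<bar> / 2\<close> by blast
  moreover have "L2_norm M u = 0"
    if "u \<in> orthocomplement M S" "L2_norm M (\<lambda>x. Q u x - l * u x) = 0" for u
    using no_eig that eigenspace_iff_norm[OF bounded orthocomplement_L2] by blast
  ultimately show ?thesis
    by (intro bounded_below_on_extend_finite[OF bounded_operator_shift[OF bounded] F(1) S _ F(2,3)])
qed

text \<open>Let \<sigma> be the norm of \<open>Q\<close> on the complement, assumed positive. The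
  product (Q - \<sigma>)(Q + \<sigma>) = Q^2 - \<sigma>^2 is bounded below by c1 c2 on unit vectors
  v, and it treats both signs at once. Symmetry gives ||Q^2 v - \<sigma>^2 v||^2 \<le> \<sigma>^2
  (\<sigma>^2 - ||Q v||^2), so ||Q v|| stays away from \<sigma> uniformly, against the definition of
  \<sigma> as a supremum.\<close>

lemma vanishes_if_no_eigenvectors:
  assumes S: "S \<subseteq> Lp_space 2 M"
    and inv: "\<And>u. u \<in> orthocomplement M S \<Longrightarrow> Q u \<in> orthocomplement M S"
    and no_eig: "\<And>u l. l \<noteq> 0 \<Longrightarrow> u \<in> orthocomplement M S \<Longrightarrow> u \<in> eigenspace M Q l \<Longrightarrow>
      L2_norm M u = 0"
    and u: "u \<in> orthocomplement M S"
  shows "L2_norm M (Q u) = 0"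
proof (rule ccontr)
  assume nz: "L2_norm M (Q u) \<noteq> 0"
  let ?X = "orthocomplement M S"
  define U where "U = {v \<in> ?X. L2_norm M v = 1}"
  obtain K where K: "0 \<le> K" "\<And>f. f \<in> Lp_space 2 M \<Longrightarrow> L2_norm M (Q f) \<le> K * L2_norm M f"
    using operator_norm_bound[OF bounded] by blast
  define \<sigma> where "\<sigma> = (SUP v\<in>U. L2_norm M (Q v))"
  have "L2_norm M (Q v) \<le> K" if "v \<in> U" for v
    using K(2)[OF orthocomplement_L2, of v S] that by (simp add: U_def)
  then have bdd: "bdd_above ((\<lambda>v. L2_norm M (Q v)) ` U)" by (intro bdd_aboveI2)
  have \<sigma>: "L2_norm M (Q v) \<le> \<sigma> * L2_norm M v" if v: "v \<in> ?X" for v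
  proof (cases "L2_norm M v = 0")
    case True
    then show ?thesis using K(2)[OF orthocomplement_L2[OF v]] by simp
  next
    case False
    let ?e = "\<lambda>x. inverse (L2_norm M v) * v x"
    have "?e \<in> U"
      unfolding U_def using orthocomplement_scale[OF v] False by (simp add: L2_norm_scale)
    then have "L2_norm M (Q ?e) \<le> \<sigma>"
      unfolding \<sigma>_def using bdd by (rule cSUP_upper)
    then have "inverse (L2_norm M v) * L2_norm M (Q v) \<le> \<sigma>"
      by (simp add: operator_norm_scale[OF bounded orthocomplement_L2[OF v]])
    then show ?thesis
      using False L2_norm_ge_0[of M v] by (simp add: field_simps order_less_le)
  qed
  have "0 < L2_norm M (Q u)" using nz by (simp add: order_less_le)
  then have "0 < \<sigma> * L2_norm M u" using \<sigma>[OF u] by linarith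
  then have "0 < \<sigma>" "0 < L2_norm M u"
    using L2_norm_ge_0[of M u] by (auto simp: zero_less_mult_iff)
  let ?P = "\<lambda>f x. Q f x - (- \<sigma>) * f x" and ?N = "\<lambda>f x. Q f x - \<sigma> * f x"
  have below: "bounded_below_on M ?X (\<lambda>f x. Q f x - l * f x)" if "l \<noteq> 0" for l
    by (rule bounded_below_if_no_eigenvector[OF S that no_eig[OF that]])
  obtain c1 where "0 < c1" and c1: "\<And>f. f \<in> ?X \<Longrightarrow> c1 * L2_norm M f \<le> L2_norm M (?N f)"
    using below[of \<sigma>] \<open>0 < \<sigma>\<close> unfolding bounded_below_on_def by auto
  obtain c2 where "0 < c2" and c2: "\<And>f. f \<in> ?X \<Longrightarrow> c2 * L2_norm M f \<le> L2_norm M (?P f)"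
    using below[of "- \<sigma>"] \<open>0 < \<sigma>\<close> unfolding bounded_below_on_def by auto
  \<comment> \<open>The bound for ||Q v||^2 obtained by solving (c1 c2)^2 \<le> \<sigma>^2
    (\<sigma>^2 - ||Q v||^2).\<close>
  define \<rho> where "\<rho> = \<sigma>\<^sup>2 - (c1 * c2 / \<sigma>)\<^sup>2"
  have \<rho>: "(L2_norm M (Q v))\<^sup>2 \<le> \<rho>" if v: "v \<in> U" for v
  proof -
    have vX: "v \<in> ?X" and v1: "L2_norm M v = 1" using v by (auto simp: U_def)
    note vL2 = orthocomplement_L2[OF vX] and QL2 = operator_L2[OF bounded]
    \<comment> \<open>Invariance of the complement enters here: the lower bound for Q - \<sigma> is
      applied to Q v + \<sigma> v.\<close>
    have PX: "?P v \<in> ?X"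
      by (intro orthocomplement_diff[OF S] inv vX orthocomplement_scale)
    have "AE x in M. ?N (?P v) x = Q (Q v) x - \<sigma>\<^sup>2 * v x"
      using operator_diff[OF bounded QL2[OF vL2] L2_scale[OF vL2, of "- \<sigma>"]]
        operator_scale[OF bounded vL2, of "- \<sigma>"]
      by eventually_elim (simp add: algebra_simps power2_eq_square)
    then have "L2_norm M (?N (?P v)) = L2_norm M (\<lambda>x. Q (Q v) x - \<sigma>\<^sup>2 * v x)"
      by (intro L2_norm_cong_AE L2_diff L2_scale QL2 vL2)
    moreover have "c1 * c2 \<le> c1 * L2_norm M (?P v)"
      using c2[OF vX] \<open>0 < c1\<close> v1 by (intro mult_left_mono) auto
    ultimately have "c1 * c2 \<le> L2_norm M (\<lambda>x. Q (Q v) x - \<sigma>\<^sup>2 * v x)"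
      using c1[OF PX] by linarith
    then have "(c1 * c2)\<^sup>2 \<le> (L2_norm M (\<lambda>x. Q (Q v) x - \<sigma>\<^sup>2 * v x))\<^sup>2"
      using \<open>0 < c1\<close> \<open>0 < c2\<close> by (intro power_mono) auto
    also have "(L2_norm M (\<lambda>x. Q (Q v) x - \<sigma>\<^sup>2 * v x))\<^sup>2
        = (L2_norm M (Q (Q v)))\<^sup>2 - 2 * \<sigma>\<^sup>2 * (L2_norm M (Q v))\<^sup>2 + \<sigma>\<^sup>2 * \<sigma>\<^sup>2"
    proof -
      have "L2_inner M (Q (Q v)) v = (L2_norm M (Q v))\<^sup>2"
        by (simp add: inner_symmetric[OF QL2[OF vL2] vL2] L2_norm_sq)
      then show ?thesis
        using L2_norm_diff_sq[OF QL2[OF QL2[OF vL2]] L2_scale[OF vL2, of "\<sigma>\<^sup>2"]] v1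
        by (simp add: L2_norm_scale L2_inner_scale_right power2_eq_square)
    qed
    also have "(L2_norm M (Q (Q v)))\<^sup>2 \<le> \<sigma>\<^sup>2 * (L2_norm M (Q v))\<^sup>2"
      using power_mono[OF \<sigma>[OF inv[OF vX]], of 2] by (simp add: power_mult_distrib)
    finally have "(c1 * c2)\<^sup>2 \<le> \<sigma>\<^sup>2 * (\<sigma>\<^sup>2 - (L2_norm M (Q v))\<^sup>2)"
      by (simp add: algebra_simps)
    then have "(c1 * c2)\<^sup>2 / \<sigma>\<^sup>2 \<le> \<sigma>\<^sup>2 - (L2_norm M (Q v))\<^sup>2"
      using \<open>0 < \<sigma>\<close> by (simp add: pos_divide_le_eq mult.commute)
    then show ?thesis by (simp add: \<rho>_def power_divide)
  qed
  have "\<rho> < \<sigma>\<^sup>2" using \<open>0 < c1\<close> \<open>0 < c2\<close> \<open>0 < \<sigma>\<close> by (simp add: \<rho>_def)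
  then have "sqrt \<rho> < \<sigma>"
    using \<open>0 < \<sigma>\<close> real_sqrt_less_mono[of \<rho> "\<sigma>\<^sup>2"] by simp
  moreover have "(\<lambda>x. inverse (L2_norm M u) * u x) \<in> U"
    unfolding U_def using orthocomplement_scale[OF u] \<open>0 < L2_norm M u\<close> by (simp add: L2_norm_scale)
  then have "\<sigma> \<le> sqrt \<rho>"
    unfolding \<sigma>_def by (intro cSUP_least) (auto intro: real_le_rsqrt \<rho>)
  ultimately show False by simp
qed

section \<open>Resolvent and spectrum\<close>

lemma shift_symmetric:
  assumes "f \<in> Lp_space 2 M" "g \<in> Lp_space 2 M"
  shows "L2_inner M (\<lambda>x. Q f x - l * f x) g = L2_inner M f (\<lambda>x. Q g x - l * g x)"
  using assms inner_symmetric[OF assms]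
  by (simp add: L2_inner_diff_left L2_inner_diff_right L2_scale operator_L2[OF bounded]
      L2_inner_scale_left L2_inner_scale_right)

text \<open>The least-squares residual r is orthogonal to the range of Q - l, so by symmetry (Q - l)
  r = 0, and the lower bound leaves only r = 0. An explicit step length takes the place of
  differentiation at the minimiser.\<close>

lemma shift_surjective:
  assumes below: "bounded_below_on M (Lp_space 2 M) (\<lambda>f x. Q f x - l * f x)"
    and f: "f \<in> Lp_space 2 M"
  shows "\<exists>u\<in>Lp_space 2 M. AE x in M. Q u x - l * u x = f x"
proof -
  let ?T = "\<lambda>f x. Q f x - l * f x"
  note T = bounded_operator_shift[OF bounded, of l]
  have X: "orthocomplement M {} = Lp_space 2 M" by (simp add: orthocomplement_def)
  obtain c where "0 < c" and c: "\<And>y. y \<in> Lp_space 2 M \<Longrightarrow> c * L2_norm M y \<le> L2_norm M (?T y)"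
    using below unfolding bounded_below_on_def by blast
  obtain K where K: "0 \<le> K" "\<And>g. g \<in> Lp_space 2 M \<Longrightarrow> L2_norm M (?T g) \<le> K * L2_norm M g"
    using operator_norm_bound[OF T] by blast
  obtain y where y: "y \<in> Lp_space 2 M"
    and y_min: "\<And>z. z \<in> Lp_space 2 M \<Longrightarrow>
      L2_norm M (\<lambda>x. ?T y x - f x) \<le> L2_norm M (\<lambda>x. ?T z x - f x)"
    using nearest_point_of_range[OF T, of "{}" f] below f unfolding X by auto
  define r where "r = (\<lambda>x. ?T y x - f x)"
  have r: "r \<in> Lp_space 2 M"
    unfolding r_def by (intro L2_diff operator_L2[OF T] y f)
  \<comment> \<open>the variation of the minimiser in the direction \<open>(Q - l) r\<close>\<close>
  define z where "z = ?T r"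
  have z: "z \<in> Lp_space 2 M" unfolding z_def by (rule operator_L2[OF T r])
  define a where "a = (L2_norm M z)\<^sup>2"
  \<comment> \<open>Small enough that the quadratic term, at most t^2 K^2 a, does not exceed t a,
    half of the linear gain 2 t a. The summand 1 avoids division by 0 when K = 0.\<close>
  define t where "t = 1 / (K\<^sup>2 + 1)"
  have "0 < t" and tK: "t * K\<^sup>2 \<le> 1"
    by (auto simp: t_def add_nonneg_pos)
  have "AE x in M. ?T (\<lambda>x. y x - t * z x) x - f x = r x - t * ?T z x"
    using operator_diff[OF T y L2_scale[OF z, of t]] operator_scale[OF T z, of t]
    unfolding r_def by eventually_elim simp
  then have "L2_norm M (\<lambda>x. ?T (\<lambda>x. y x - t * z x) x - f x) = L2_norm M (\<lambda>x. r x - t * ?T z x)"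
    by (intro L2_norm_cong_AE L2_diff L2_scale operator_L2[OF bounded] f r y z)
  moreover have "L2_norm M r \<le> L2_norm M (\<lambda>x. ?T (\<lambda>x. y x - t * z x) x - f x)"
    unfolding r_def by (intro y_min L2_diff L2_scale y z)
  ultimately have "(L2_norm M r)\<^sup>2 \<le> (L2_norm M (\<lambda>x. r x - t * ?T z x))\<^sup>2"
    by (intro power_mono) auto
  also have "\<dots> = (L2_norm M r)\<^sup>2 - 2 * t * a + t\<^sup>2 * (L2_norm M (?T z))\<^sup>2"
    using L2_norm_diff_sq[OF r L2_scale[OF operator_L2[OF T z], of t]] shift_symmetric[OF r z, of l]
    by (simp add: L2_inner_scale_right L2_norm_scale power_mult_distrib a_def L2_norm_sq[of M z])
       (simp add: z_def)
  finally have "2 * t * a \<le> t\<^sup>2 * (L2_norm M (?T z))\<^sup>2" by simp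
  also have "\<dots> \<le> t\<^sup>2 * (K\<^sup>2 * a)"
    using power_mono[OF K(2)[OF z], of 2] by (intro mult_left_mono) (auto simp: power_mult_distrib a_def)
  also have "\<dots> = t * (t * K\<^sup>2) * a" by (simp add: power2_eq_square)
  also have "\<dots> \<le> t * 1 * a"
    using \<open>0 < t\<close> tK by (intro mult_right_mono mult_left_mono) (auto simp: a_def)
  finally have "t * a \<le> 0" by (simp add: mult.commute)
  then have "a \<le> 0"
    using \<open>0 < t\<close> by (simp add: mult_le_0_iff)
  then have "L2_norm M z = 0" by (simp add: a_def)
  then have "L2_norm M r = 0"
    using c[OF r] \<open>0 < c\<close> L2_norm_ge_0[of M r] by (auto simp: z_def mult_le_0_iff)
  then have "AE x in M. r x = 0" using L2_norm_eq_0_iff[OF r] by blast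
  then have "AE x in M. ?T y x = f x" unfolding r_def by eventually_elim simp
  with y show ?thesis by blast
qed

text \<open>Preimages under Q - l are picked arbitrarily, so linearity and compatibility with null
  sets are not built into the inverse. They follow almost everywhere from uniqueness, by applying Q
  - l to both sides; the lower bound gives the norm bound 1 / c.\<close>

lemma not_in_spectrum:
  assumes below: "bounded_below_on M (Lp_space 2 M) (\<lambda>f x. Q f x - l * f x)"
  shows "l \<notin> spectrum M Q"
proof -
  let ?T = "\<lambda>f x. Q f x - l * f x"
  note T = bounded_operator_shift[OF bounded, of l]
  obtain c where "0 < c" and c: "\<And>y. y \<in> Lp_space 2 M \<Longrightarrow> c * L2_norm M y \<le> L2_norm M (?T y)"
    using below unfolding bounded_below_on_def by blast
  define R where "R f = (SOME u. u \<in> Lp_space 2 M \<and> (AE x in M. Q u x - l * u x = f x))" for f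
  have "R f \<in> Lp_space 2 M \<and> (AE x in M. Q (R f) x - l * R f x = f x)"
    if "f \<in> Lp_space 2 M" for f
    using someI_ex[OF shift_surjective[OF below that, unfolded Bex_def]] unfolding R_def .
  then have R: "\<And>f. f \<in> Lp_space 2 M \<Longrightarrow> R f \<in> Lp_space 2 M"
    and TR: "\<And>f. f \<in> Lp_space 2 M \<Longrightarrow> AE x in M. Q (R f) x - l * R f x = f x"
    by blast+
  have unique: "AE x in M. u x = v x"
    if u: "u \<in> Lp_space 2 M" and v: "v \<in> Lp_space 2 M" and eq: "AE x in M. ?T u x = ?T v x" for u v
  proof -
    have "AE x in M. ?T (\<lambda>x. u x - v x) x = 0"
      using operator_diff[OF T u v] eq by eventually_elim simp
    then have "L2_norm M (?T (\<lambda>x. u x - v x)) = 0"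
      using L2_norm_eq_0_iff[OF operator_L2[OF T L2_diff[OF u v]]] by blast
    then have "L2_norm M (\<lambda>x. u x - v x) = 0"
      using c[OF L2_diff[OF u v]] \<open>0 < c\<close> L2_norm_ge_0[of M "\<lambda>x. u x - v x"]
      by (auto simp: mult_le_0_iff)
    then have "AE x in M. u x - v x = 0"
      using L2_norm_eq_0_iff[OF L2_diff[OF u v]] by blast
    then show ?thesis by eventually_elim simp
  qed
  have "bounded_operator 2 2 M R"
    unfolding bounded_operator_2_iff
  proof (intro conjI ballI allI impI)
    show "R \<in> Lp_space 2 M \<rightarrow> Lp_space 2 M" using R by blast
  next
    fix f g assume fg: "f \<in> Lp_space 2 M" "g \<in> Lp_space 2 M" and eq: "AE x in M. f x = g x"
    show "AE x in M. R f x = R g x"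
    proof (rule unique[OF R R, OF fg])
      show "AE x in M. ?T (R f) x = ?T (R g) x"
        using TR[OF fg(1)] TR[OF fg(2)] eq by eventually_elim simp
    qed
  next
    fix f g assume fg: "f \<in> Lp_space 2 M" "g \<in> Lp_space 2 M"
    show "AE x in M. R (\<lambda>y. f y + g y) x = R f x + R g x"
    proof (rule unique[OF R[OF L2_add[OF fg]] L2_add[OF R R, OF fg]])
      show "AE x in M. ?T (R (\<lambda>y. f y + g y)) x = ?T (\<lambda>x. R f x + R g x) x"
        using operator_add[OF T R[OF fg(1)] R[OF fg(2)]]
          TR[OF fg(1)] TR[OF fg(2)] TR[OF L2_add[OF fg]] by eventually_elim simp
    qed
  next
    fix f k assume f: "f \<in> Lp_space 2 M"
    show "AE x in M. R (\<lambda>y. k * f y) x = k * R f x"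
    proof (rule unique[OF R[OF L2_scale[OF f]] L2_scale[OF R[OF f]]])
      show "AE x in M. ?T (R (\<lambda>y. k * f y)) x = ?T (\<lambda>x. k * R f x) x"
        using operator_scale[OF T R[OF f], of k] TR[OF f] TR[OF L2_scale[OF f, of k]]
        by eventually_elim simp
    qed
  next
    have "L2_norm M (R f) \<le> 1 / c * L2_norm M f" if f: "f \<in> Lp_space 2 M" for f
    proof -
      have "L2_norm M (?T (R f)) = L2_norm M f"
        by (intro L2_norm_cong_AE operator_L2[OF T] R f TR)
      then show ?thesis using c[OF R[OF f]] \<open>0 < c\<close> by (simp add: field_simps)
    qed
    then show "\<exists>K\<ge>0. \<forall>f\<in>Lp_space 2 M. L2_norm M (R f) \<le> K * L2_norm M f"
      using \<open>0 < c\<close> by (intro exI[of _ "1 / c"]) auto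
  qed
  moreover have "AE x in M. R (?T f) x = f x" if f: "f \<in> Lp_space 2 M" for f
    by (rule unique[OF R[OF operator_L2[OF T f]] f TR[OF operator_L2[OF T f]]])
  ultimately show ?thesis
    unfolding spectrum_def using TR by blast
qed

lemma eigenvalue_in_spectrum:
  assumes e: "e \<in> eigenspace M Q l" and nz: "L2_norm M e \<noteq> 0"
  shows "l \<in> spectrum M Q"
  unfolding spectrum_def
proof (intro CollectI notI)
  note eL2 = eigenspace_L2[OF e]
  assume "\<exists>R. bounded_operator 2 2 M R \<and> (\<forall>f\<in>Lp_space 2 M.
      (AE x in M. R (\<lambda>y. Q f y - l * f y) x = f x) \<and> (AE x in M. Q (R f) x - l * R f x = f x))"
  then obtain R where R: "bounded_operator 2 2 M R"
    and inv: "AE x in M. R (\<lambda>y. Q e y - l * e y) x = e x"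
    using eL2 by blast
  have "AE x in M. Q e x - l * e x = 0"
    using e by (simp add: eigenspace_def)
  then have "AE x in M. R (\<lambda>y. Q e y - l * e y) x = 0"
    by (intro operator_zero[OF R] L2_diff L2_scale operator_L2[OF bounded] eL2)
  with inv have "AE x in M. e x = 0" by eventually_elim simp
  with nz L2_norm_eq_0_iff[OF eL2] show False by blast
qed

lemma eigenspace_orthogonal:
  assumes e: "e \<in> eigenspace M Q l" and e': "e' \<in> eigenspace M Q l'" and "l \<noteq> l'"
  shows "L2_inner M e e' = 0"
proof -
  note L2 = eigenspace_L2[OF e] eigenspace_L2[OF e']
  have "L2_inner M (Q e) e' = L2_inner M (\<lambda>x. l * e x) e'"
    using e by (intro L2_inner_cong_AE operator_L2[OF bounded] L2 L2_scale) (auto simp: eigenspace_def)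
  moreover have "L2_inner M e (Q e') = L2_inner M e (\<lambda>x. l' * e' x)"
    using e' by (intro L2_inner_cong_AE operator_L2[OF bounded] L2 L2_scale) (auto simp: eigenspace_def)
  ultimately have "l * L2_inner M e e' = l' * L2_inner M e e'"
    using inner_symmetric[OF L2] by (simp only: L2_inner_scale_left L2_inner_scale_right)
  with \<open>l \<noteq> l'\<close> show ?thesis by (metis mult_cancel_right)
qed

text \<open>Orthonormal bases of all eigenspaces are united, the kernel of \<open>Q\<close>
  included. By symmetry the eigenspaces are mutually orthogonal and the complement of the union is
  invariant.\<close>

theorem exists_discrete_spectrum:
  obtains B \<mu> where "discrete_spectrum M Q B \<mu>" "\<And>e. e \<in> B \<Longrightarrow> L2_norm M (Q e) = \<bar>\<mu> e\<bar>"
proof -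
  have "\<exists>B. orthonormal_basis M (eigenspace M Q l) B" for l
    by (intro exists_orthonormal_basis eigenspace_scale[OF bounded])
       (auto simp: eigenspace_L2)
  then obtain b where b: "\<And>l. orthonormal_basis M (eigenspace M Q l) (b l)" by metis
  then have b_eig: "\<And>l. b l \<subseteq> eigenspace M Q l" and b_on: "\<And>l. orthonormal M (b l)"
    and b_complete: "\<And>l f. f \<in> eigenspace M Q l \<Longrightarrow> (\<And>e. e \<in> b l \<Longrightarrow> L2_inner M f e = 0) \<Longrightarrow>
      AE x in M. f x = 0"
    by (auto simp: orthonormal_basis_iff)
  define B where "B = (\<Union>l. b l)"
  \<comment> \<open>The choice is unique because the bases for different \<open>l\<close> are
    disjoint: a common vector would be orthogonal to itself.\<close>
  define \<mu> where "\<mu> e = (SOME l. e \<in> b l)" for e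
  have disj: "l = l'" if "e \<in> b l" "e \<in> b l'" for e l l'
  proof (rule ccontr)
    assume "l \<noteq> l'"
    then have "L2_inner M e e = 0" using eigenspace_orthogonal b_eig that by blast
    moreover have "L2_inner M e e = 1" using b_on that unfolding orthonormal_def by auto
    ultimately show False by simp
  qed
  have \<mu>: "\<mu> e = l" if "e \<in> b l" for e l
    unfolding \<mu>_def using that disj by blast
  have B_\<mu>: "{e \<in> B. \<mu> e = l} = b l" for l
    using \<mu> by (auto simp: B_def)
  have B_L2: "B \<subseteq> Lp_space 2 M" using b_eig eigenspace_L2 unfolding B_def by blast
  have B_norm: "L2_norm M e = 1" if "e \<in> B" for e
    using that b_on L2_norm_orthonormal unfolding B_def by blast
  have B_eig: "e \<in> eigenspace M Q (\<mu> e)" if "e \<in> B" for e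
    using that b_eig \<mu> unfolding B_def by blast
  have Q_norm: "L2_norm M (Q e) = \<bar>\<mu> e\<bar>" if "e \<in> B" for e
    using eigenspace_norm[OF bounded B_eig[OF that]] B_norm[OF that] by simp
  have B_on: "orthonormal M B"
    unfolding orthonormal_def
  proof (intro ballI)
    fix e e' assume "e \<in> B" "e' \<in> B"
    then obtain l l' where "e \<in> b l" "e' \<in> b l'" unfolding B_def by blast
    then show "L2_inner M e e' = (if e = e' then 1 else 0)"
      using eigenspace_orthogonal[of e l e' l'] b_eig b_on[of l] disj
      by (cases "l = l'") (auto simp: orthonormal_def)
  qed
  have no_eig: "L2_norm M u = 0" if "u \<in> orthocomplement M B" "u \<in> eigenspace M Q l" for u l
  proof -
    have "AE x in M. u x = 0"
      using that by (intro b_complete[of u l]) (auto simp: orthocomplement_def B_def)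
    then show ?thesis using L2_norm_eq_0_iff eigenspace_L2[OF that(2)] by blast
  qed
  have inv: "Q u \<in> orthocomplement M B" if u: "u \<in> orthocomplement M B" for u
    unfolding orthocomplement_def
  proof (intro CollectI conjI ballI operator_L2[OF bounded] orthocomplement_L2[OF u])
    fix e assume e: "e \<in> B"
    note L2 = orthocomplement_L2[OF u] eigenspace_L2[OF B_eig[OF e]]
    have "L2_inner M (Q u) e = L2_inner M u (Q e)" by (rule inner_symmetric[OF L2])
    also have "\<dots> = L2_inner M u (\<lambda>x. \<mu> e * e x)"
      using B_eig[OF e]
      by (intro L2_inner_cong_AE operator_L2[OF bounded] L2 L2_scale) (auto simp: eigenspace_def)
    also have "\<dots> = 0" using u e by (simp add: L2_inner_scale_right orthocomplement_def)
    finally show "L2_inner M (Q u) e = 0" .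
  qed
  have "AE x in M. f x = 0" if "f \<in> orthocomplement M B" for f
  proof -
    have "L2_norm M (Q f) = 0"
      by (rule vanishes_if_no_eigenvectors[OF B_L2 inv no_eig that])
    \<comment> \<open>What remains after the eigenspaces for nonzero eigenvalues lies in the kernel,
      whose basis \<open>b 0\<close> already belongs to \<open>B\<close>.\<close>
    then have "f \<in> eigenspace M Q 0"
      using eigenspace_iff_norm[OF bounded orthocomplement_L2[OF that]] by simp
    from no_eig[OF that this] show ?thesis
      using L2_norm_eq_0_iff orthocomplement_L2[OF that] by blast
  qed
  then have basis: "orthonormal_basis M (Lp_space 2 M) B"
    using B_L2 B_on by (auto simp: orthonormal_basis_iff orthocomplement_def)
  have "spectrum M Q - {0} = \<mu> ` B - {0}"
  proof (intro equalityI subsetI)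
    fix l assume "l \<in> \<mu> ` B - {0}"
    then obtain e where "e \<in> B" "l = \<mu> e" "l \<noteq> 0" by blast
    with eigenvalue_in_spectrum[OF B_eig] B_norm show "l \<in> spectrum M Q - {0}" by auto
  next
    fix l assume l: "l \<in> spectrum M Q - {0}"
    show "l \<in> \<mu> ` B - {0}"
    proof (rule ccontr)
      assume "l \<notin> \<mu> ` B - {0}"
      with l have "{e \<in> B. \<mu> e = l} = {}" by blast
      then have "b l = {}" using B_\<mu>[of l] by simp
      then have "L2_norm M u = 0" if "u \<in> eigenspace M Q l" for u
        using b_complete[OF that] L2_norm_eq_0_iff eigenspace_L2[OF that] by blast
      then have "bounded_below_on M (orthocomplement M {}) (\<lambda>f x. Q f x - l * f x)"
        using l by (intro bounded_below_if_no_eigenvector) auto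
      then have "l \<notin> spectrum M Q"
        by (intro not_in_spectrum) (simp add: orthocomplement_def)
      with l show False by blast
    qed
  qed
  moreover have "finite {e \<in> B. \<epsilon> \<le> \<bar>\<mu> e\<bar>}" if "0 < \<epsilon>" for \<epsilon>
  proof (rule ccontr)
    assume "infinite {e \<in> B. \<epsilon> \<le> \<bar>\<mu> e\<bar>}"
    \<comment> \<open>\<open>n\<close> basis vectors with eigenvalues of modulus at least \<epsilon>
      would push the sum of ||Q e||^2 above \<open>C\<close>.\<close>
    obtain n where n: "C < real n * \<epsilon>\<^sup>2"
      using \<open>0 < \<epsilon>\<close> ex_less_of_nat_mult[of "\<epsilon>\<^sup>2" C] by auto
    obtain F where F: "F \<subseteq> {e \<in> B. \<epsilon> \<le> \<bar>\<mu> e\<bar>}" "finite F" "card F = n"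
      using infinite_arbitrarily_large[OF \<open>infinite _\<close>] by blast
    have "real n * \<epsilon>\<^sup>2 = (\<Sum>e\<in>F. \<epsilon>\<^sup>2)" using F by simp
    also have "\<dots> \<le> (\<Sum>e\<in>F. (L2_norm M (Q e))\<^sup>2)"
      using F(1) Q_norm \<open>0 < \<epsilon>\<close> by (intro sum_mono power_mono) auto
    also have "\<dots> \<le> C"
      using F B_L2 orthonormal_subset[OF B_on, of F] by (intro trace_bound) auto
    finally show False using n by simp
  qed
  ultimately have "discrete_spectrum M Q B \<mu>"
    unfolding discrete_spectrum_def using basis b B_\<mu> by simp
  with Q_norm show ?thesis using that by blast
qed

end

section \<open>Operators dominated by a weight\<close>

lemma Lp_norm_1_integrable:
  assumes "integrable M f"
  shows "Lp_norm 1 M f = ennreal (\<integral>x. \<bar>f x\<bar> \<partial>M)"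
  using assms by (simp add: Lp_norm_1 nn_integral_eq_integral)

lemma tendsto_floor_mult_div:
  "(\<lambda>m. of_int \<lfloor>real (Suc m) * q\<rfloor> / real (Suc m)) \<longlonglongrightarrow> q"
proof (rule tendsto_sandwich)
  show "(\<lambda>m. q - inverse (real (Suc m))) \<longlonglongrightarrow> q"
    using tendsto_diff[OF tendsto_const LIMSEQ_inverse_real_of_nat, of q] by simp
  have "q - inverse (real (Suc m)) \<le> of_int \<lfloor>real (Suc m) * q\<rfloor> / real (Suc m)" for m
  proof -
    have "real (Suc m) * q - 1 \<le> of_int \<lfloor>real (Suc m) * q\<rfloor>" by linarith
    then have "(real (Suc m) * q - 1) / real (Suc m) \<le> of_int \<lfloor>real (Suc m) * q\<rfloor> / real (Suc m)"
      by (rule divide_right_mono) simp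
    then show ?thesis by (simp add: diff_divide_distrib inverse_eq_divide del: of_nat_Suc)
  qed
  then show "\<forall>\<^sub>F m in sequentially.
      q - inverse (real (Suc m)) \<le> of_int \<lfloor>real (Suc m) * q\<rfloor> / real (Suc m)"
    by simp
  have "of_int \<lfloor>real (Suc m) * q\<rfloor> / real (Suc m) \<le> q" for m
  proof -
    have "of_int \<lfloor>real (Suc m) * q\<rfloor> / real (Suc m) \<le> real (Suc m) * q / real (Suc m)"
      by (rule divide_right_mono) auto
    then show ?thesis by (simp del: of_nat_Suc)
  qed
  then show "\<forall>\<^sub>F m in sequentially. of_int \<lfloor>real (Suc m) * q\<rfloor> / real (Suc m) \<le> q"
    by simp
qed simp

lemma L2_norm_orthonormal_sum:
  assumes "finite F" "F \<subseteq> Lp_space 2 M" "orthonormal M F"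
  shows "L2_norm M (\<lambda>x. \<Sum>e\<in>F. c e * e x) = sqrt (\<Sum>e\<in>F. (c e)\<^sup>2)"
proof -
  have L2: "(\<lambda>x. c e * e x) \<in> Lp_space 2 M" if "e \<in> F" for e
    using assms that by (intro L2_scale) auto
  have sum: "(\<lambda>x. \<Sum>e\<in>F. c e * e x) \<in> Lp_space 2 M" using L2 by (rule L2_sum)
  have "L2_inner M (\<lambda>x. \<Sum>e\<in>F. c e * e x) e = c e" if "e \<in> F" for e
  proof -
    have "L2_inner M e (\<lambda>x. \<Sum>e\<in>F. c e * e x) = (\<Sum>e'\<in>F. c e' * L2_inner M e e')"
      using assms that by (subst L2_inner_sum_right) (auto intro: L2 simp: L2_inner_scale_right)
    also have "\<dots> = (\<Sum>e'\<in>F. if e = e' then c e' else 0)"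
      using assms(3) that by (intro sum.cong) (auto simp: orthonormal_def)
    also have "\<dots> = c e" using assms(1) that by simp
    finally show ?thesis by (simp only: L2_inner_commute[of M e])
  qed
  then have "L2_inner M (\<lambda>x. \<Sum>e\<in>F. c e * e x) (\<lambda>x. \<Sum>e\<in>F. c e * e x) = (\<Sum>e\<in>F. c e * c e)"
    using L2 sum by (simp add: L2_inner_sum_right L2_inner_scale_right)
  then show ?thesis by (simp add: L2_norm_def power2_eq_square)
qed

section \<open>Symmetric operators with a positive weight; the kernel bound implies the
  domination\<close>

locale weighted_symmetric_operator = sigma_finite_measure M for M :: "'a measure" +
  fixes Q :: "('a \<Rightarrow> real) \<Rightarrow> ('a \<Rightarrow> real)" and V :: "'a \<Rightarrow> real"
  assumes bounded: "bounded_operator 2 2 M Q"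
    and symmetric: "symmetric_operator M Q"
    and V_measurable [measurable]: "V \<in> borel_measurable M"
    and V_pos: "\<And>x. x \<in> space M \<Longrightarrow> 0 < V x"
begin

lemma Q_L2: "f \<in> Lp_space 2 M \<Longrightarrow> Q f \<in> Lp_space 2 M"
  by (rule operator_L2[OF bounded])

lemma inner_symmetric:
  "f \<in> Lp_space 2 M \<Longrightarrow> g \<in> Lp_space 2 M \<Longrightarrow> L2_inner M (Q f) g = L2_inner M f (Q g)"
  using symmetric by (simp add: symmetric_operator_def)

lemma AE_V_pos: "AE x in M. 0 < V x"
  using V_pos by simp

lemma dominated_if_kernel_bound:
  assumes rep: "represented_by_kernel M {f \<in> Lp_space 2 M. Lp_norm 1 M (\<lambda>x. f x * V x) < \<infinity>}
      (\<lambda>f. Q (Q f)) q"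
    and bound: "AE (x, y) in M \<Otimes>\<^sub>M M. \<bar>q (x, y)\<bar> \<le> V x * V y"
    and f: "f \<in> Lp_space 2 M"
  shows "Lp_norm 2 M (Q f) \<le> Lp_norm 1 M (\<lambda>x. f x * V x)"
proof (cases "Lp_norm 1 M (\<lambda>x. f x * V x) < \<infinity>")
  \<comment> \<open>An infinite right-hand side leaves nothing to prove; the kernel represents Q^2
    only on functions of finite weighted norm.\<close>
  case False
  then show ?thesis by (simp add: not_less top_unique)
next
  case True
  note [measurable] = Lp_space_2_measurable[OF f] Lp_space_2_measurable[OF Q_L2[OF Q_L2[OF f]]]
  have int: "integrable M (\<lambda>x. f x * V x)"
    using True by (auto simp: Lp_norm_1 integrable_iff_bounded)
  define I where "I = (\<integral>x. \<bar>f x * V x\<bar> \<partial>M)"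
  have kernel: "AE x in M. integrable M (\<lambda>y. q (x, y) * f y) \<and> Q (Q f) x = (\<integral>y. q (x, y) * f y \<partial>M)"
    using rep f True by (simp add: represented_by_kernel_def)
  interpret P: pair_sigma_finite M M ..
  have "AE x in M. AE y in M. \<bar>q (x, y)\<bar> \<le> V x * V y"
    using P.AE_pair[OF bound] by simp
  then have "AE x in M. \<bar>Q (Q f) x\<bar> \<le> V x * I"
    using kernel
  proof eventually_elim
    case (elim x)
    then have "\<bar>Q (Q f) x\<bar> \<le> (\<integral>y. norm (q (x, y) * f y) \<partial>M)"
      using integral_norm_bound[of M "\<lambda>y. q (x, y) * f y"] by simp
    also have "\<dots> \<le> (\<integral>y. V x * \<bar>f y * V y\<bar> \<partial>M)"
    proof (rule integral_mono_AE)
      show "AE y in M. norm (q (x, y) * f y) \<le> V x * \<bar>f y * V y\<bar>"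
        using elim(1) AE_V_pos
      proof eventually_elim
        case (elim y)
        have "\<bar>q (x, y)\<bar> * \<bar>f y\<bar> \<le> V x * V y * \<bar>f y\<bar>"
          using elim(1) by (rule mult_right_mono) simp
        then show ?case using elim(2) by (simp add: abs_mult mult_ac)
      qed
    qed (use elim int in auto)
    finally show ?case by (simp add: I_def)
  qed
  then have le: "AE x in M. Q (Q f) x * f x \<le> I * \<bar>f x * V x\<bar>"
    using AE_V_pos
  proof eventually_elim
    case (elim x)
    have "Q (Q f) x * f x \<le> \<bar>Q (Q f) x\<bar> * \<bar>f x\<bar>" by (simp flip: abs_mult)
    also have "\<dots> \<le> V x * I * \<bar>f x\<bar>" using elim(1) by (rule mult_right_mono) simp
    finally show ?case using elim(2) by (simp add: abs_mult mult_ac)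
  qed
  \<comment> \<open>The kernel contributes one factor \<open>I\<close> together with a weight V(x);
    pairing with \<open>f\<close> turns that weight into the second factor \<open>I\<close>.\<close>
  have "(L2_norm M (Q f))\<^sup>2 = (\<integral>x. Q (Q f) x * f x \<partial>M)"
    using inner_symmetric[OF Q_L2[OF f] f] by (simp add: L2_norm_sq L2_inner_def)
  also have "\<dots> \<le> (\<integral>x. I * \<bar>f x * V x\<bar> \<partial>M)"
    using le int L2_mult_integrable[OF Q_L2[OF Q_L2[OF f]] f] by (intro integral_mono_AE) auto
  also have "\<dots> = I\<^sup>2" by (simp add: I_def power2_eq_square)
  finally have "L2_norm M (Q f) \<le> I"
    by (rule power2_le_imp_le) (simp add: I_def)
  then show ?thesis
    by (simp add: Lp_norm_2[OF Q_L2[OF f]] Lp_norm_1_integrable[OF int] I_def)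
qed

end

locale dominated_symmetric_operator = weighted_symmetric_operator +
  assumes dominated: "\<And>f. f \<in> Lp_space 2 M \<Longrightarrow> Lp_norm 2 M (Q f) \<le> Lp_norm 1 M (\<lambda>x. f x * V x)"
begin

section \<open>The pointwise bound and its sums over orthonormal families\<close>

lemma dominated_integral:
  assumes "f \<in> Lp_space 2 M" "integrable M (\<lambda>x. f x * V x)"
  shows "L2_norm M (Q f) \<le> (\<integral>x. \<bar>f x * V x\<bar> \<partial>M)"
  using dominated[OF assms(1)]
  by (simp add: Lp_norm_2[OF Q_L2[OF assms(1)]] Lp_norm_1_integrable[OF assms(2)])

text \<open>With N = ||u||, symmetry and domination bound the integral of Q u f by N times the
  integral of |f| V. Pointwise, Q u f exceeds N |f| V strictly on the set where |Q u| > N V and both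
  vanish elsewhere, so that set is null.\<close>

lemma pointwise_bound:
  assumes u: "u \<in> Lp_space 2 M"
  shows "AE x in M. \<bar>Q u x\<bar> \<le> L2_norm M u * V x"
proof (cases "L2_norm M u = 0")
  case True
  then have "AE x in M. Q u x = 0"
    using operator_zero[OF bounded u] L2_norm_eq_0_iff[OF u] by blast
  then show ?thesis by eventually_elim (simp add: True)
next
  case False
  define N where "N = L2_norm M u"
  have "0 < N" using False by (simp add: N_def order_less_le)
  note [measurable] = Lp_space_2_measurable[OF Q_L2[OF u]]
  \<comment> \<open>The cutoff forces |f| V \<le> Q u f / N, which makes f V integrable whatever the
    size of \<open>V\<close>.\<close>
  define f where "f x = (if N * V x < \<bar>Q u x\<bar> then Q u x else 0)" for x
  have [measurable]: "f \<in> borel_measurable M" unfolding f_def by measurable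
  have f: "f \<in> Lp_space 2 M"
    by (rule L2_bound[OF Q_L2[OF u]]) (auto simp: f_def)
  have fQ: "integrable M (\<lambda>x. Q u x * f x)" by (rule L2_mult_integrable[OF Q_L2[OF u] f])
  have int: "integrable M (\<lambda>x. f x * V x)"
  proof (rule Bochner_Integration.integrable_bound)
    show "integrable M (\<lambda>x. 1 / N * (Q u x * f x))" using fQ by (rule integrable_mult_right)
    have "\<bar>f x * V x\<bar> \<le> 1 / N * (Q u x * f x)" if "0 < V x" for x
    proof (cases "N * V x < \<bar>Q u x\<bar>")
      case True
      then have "N * V x * \<bar>Q u x\<bar> \<le> \<bar>Q u x\<bar> * \<bar>Q u x\<bar>"
        by (intro mult_right_mono) auto
      then show ?thesis using True that \<open>0 < N\<close>
        by (simp add: f_def abs_mult field_simps)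
    qed (simp add: f_def)
    then show "AE x in M. norm (f x * V x) \<le> norm (1 / N * (Q u x * f x))"
      using AE_V_pos by (auto elim!: eventually_mono intro: order_trans[OF _ abs_ge_self]
          simp del: times_divide_eq_left)
  qed simp
  have "(\<integral>x. Q u x * f x \<partial>M) = L2_inner M u (Q f)"
    using inner_symmetric[OF u f] by (simp add: L2_inner_def)
  also have "\<dots> \<le> N * L2_norm M (Q f)"
    using L2_Cauchy_Schwarz[OF u Q_L2[OF f]] by (simp add: N_def)
  also have "\<dots> \<le> N * (\<integral>x. \<bar>f x * V x\<bar> \<partial>M)"
    using dominated_integral[OF f int] \<open>0 < N\<close> by (intro mult_left_mono) auto
  finally have "(\<integral>x. Q u x * f x - N * \<bar>f x * V x\<bar> \<partial>M) \<le> 0"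
    using fQ int by simp
  moreover have nonneg: "AE x in M. 0 \<le> Q u x * f x - N * \<bar>f x * V x\<bar>"
    using AE_V_pos
  proof eventually_elim
    case (elim x)
    show ?case
    proof (cases "N * V x < \<bar>Q u x\<bar>")
      case True
      then have "N * V x * \<bar>Q u x\<bar> \<le> \<bar>Q u x\<bar> * \<bar>Q u x\<bar>"
        by (intro mult_right_mono) auto
      then show ?thesis using True elim by (simp add: f_def abs_mult mult_ac)
    qed (simp add: f_def)
  qed
  ultimately have "(\<integral>x. Q u x * f x - N * \<bar>f x * V x\<bar> \<partial>M) = 0"
    by (intro order_antisym integral_nonneg_AE)
  moreover have "integrable M (\<lambda>x. Q u x * f x - N * \<bar>f x * V x\<bar>)"
    using fQ int by simp
  ultimately have "AE x in M. Q u x * f x - N * \<bar>f x * V x\<bar> = 0"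
    using integral_nonneg_eq_0_iff_AE[OF _ nonneg] by blast
  then show ?thesis
    using AE_V_pos
  proof eventually_elim
    case (elim x)
    show ?case
    proof (rule ccontr)
      assume "\<not> \<bar>Q u x\<bar> \<le> L2_norm M u * V x"
      then have lt: "N * V x < \<bar>Q u x\<bar>" by (simp add: N_def)
      moreover have "0 < \<bar>Q u x\<bar>"
        using lt elim(2) \<open>0 < N\<close> mult_pos_pos[of N "V x"] by linarith
      ultimately have "N * V x * \<bar>Q u x\<bar> < \<bar>Q u x\<bar> * \<bar>Q u x\<bar>"
        by (rule mult_strict_right_mono)
      then show False using elim lt by (simp add: f_def abs_mult mult_ac)
    qed
  qed
qed

text \<open>
  Integer combinations suffice below: they are countable in number, and \<open>\<lfloor>m q\<rfloor> / m\<close> tends to \<open>q\<close>.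
\<close>

lemma orthonormal_pointwise_bound:
  assumes F: "finite F" "F \<subseteq> Lp_space 2 M" "orthonormal M F"
  shows "AE x in M. (\<Sum>e\<in>F. (Q e x)\<^sup>2) \<le> (V x)\<^sup>2"
proof -
  let ?P = "PiE F (\<lambda>_. UNIV :: int set)"
  have "countable ?P" using F(1) by (intro countable_PiE) auto
  moreover have "AE x in M. \<bar>\<Sum>e\<in>F. of_int (k e) * Q e x\<bar> \<le> sqrt (\<Sum>e\<in>F. (of_int (k e))\<^sup>2) * V x"
    if "k \<in> ?P" for k
  proof -
    have L2: "(\<lambda>x. of_int (k e) * e x) \<in> Lp_space 2 M" if "e \<in> F" for e
      using F that by (intro L2_scale) auto
    have "AE x in M. Q (\<lambda>x. of_int (k e) * e x) x = of_int (k e) * Q e x" if "e \<in> F" for e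
      using F that by (intro operator_scale[OF bounded]) auto
    then have "AE x in M. \<forall>e\<in>F. Q (\<lambda>x. of_int (k e) * e x) x = of_int (k e) * Q e x"
      using F(1) by (simp add: AE_finite_all)
    moreover have "AE x in M. Q (\<lambda>x. \<Sum>e\<in>F. of_int (k e) * e x) x
        = (\<Sum>e\<in>F. Q (\<lambda>x. of_int (k e) * e x) x)"
      using F(1) L2 by (rule operator_sum[OF bounded])
    moreover have "AE x in M. \<bar>Q (\<lambda>x. \<Sum>e\<in>F. of_int (k e) * e x) x\<bar>
        \<le> sqrt (\<Sum>e\<in>F. (of_int (k e))\<^sup>2) * V x"
      using pointwise_bound[OF L2_sum, of F "\<lambda>e x. of_int (k e) * e x", OF L2]
      by (simp add: L2_norm_orthonormal_sum[OF F])
    ultimately show ?thesis by eventually_elim simp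
  qed
  ultimately have "AE x in M. \<forall>k\<in>?P.
      \<bar>\<Sum>e\<in>F. of_int (k e) * Q e x\<bar> \<le> sqrt (\<Sum>e\<in>F. (of_int (k e))\<^sup>2) * V x"
    by (simp add: AE_ball_countable)
  then show ?thesis
    using AE_V_pos
  proof eventually_elim
    case (elim x)
    \<comment> \<open>At a fixed x the optimal coefficients are the values Q e x, which turn the
      bound into s \<le> sqrt s V(x). They depend on x, so a single null set has to serve all
      combinations.\<close>
    define s where "s = (\<Sum>e\<in>F. (Q e x)\<^sup>2)"
    define r where "r m e = of_int \<lfloor>real (Suc m) * Q e x\<rfloor> / real (Suc m)" for m e
    have r_lim: "(\<lambda>m. r m e) \<longlonglongrightarrow> Q e x" for e
      unfolding r_def by (rule tendsto_floor_mult_div)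
    have "\<bar>\<Sum>e\<in>F. r m e * Q e x\<bar> \<le> sqrt (\<Sum>e\<in>F. (r m e)\<^sup>2) * V x" for m
    proof -
      define k where "k = restrict (\<lambda>e. \<lfloor>real (Suc m) * Q e x\<rfloor>) F"
      have rk: "real (Suc m) * r m e = of_int (k e)" if "e \<in> F" for e
        using that by (simp add: r_def k_def del: of_nat_Suc)
      \<comment> \<open>The inequality is homogeneous of degree one in the coefficients, so
        multiplication by m + 1 makes them integers.\<close>
      have "real (Suc m) * \<bar>\<Sum>e\<in>F. r m e * Q e x\<bar> = \<bar>\<Sum>e\<in>F. real (Suc m) * r m e * Q e x\<bar>"
        by (simp only: mult.assoc sum_distrib_left[symmetric] abs_mult abs_of_nat)
      also have "\<dots> = \<bar>\<Sum>e\<in>F. of_int (k e) * Q e x\<bar>"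
        using rk by simp
      also have "\<dots> \<le> sqrt (\<Sum>e\<in>F. (of_int (k e))\<^sup>2) * V x"
        by (rule bspec[OF elim(1)]) (simp only: k_def restrict_PiE_iff UNIV_I ball_triv simp_thms)
      also have "(\<Sum>e\<in>F. (of_int (k e))\<^sup>2) = (\<Sum>e\<in>F. (real (Suc m))\<^sup>2 * (r m e)\<^sup>2)"
        using rk by (intro sum.cong) (simp_all flip: power_mult_distrib)
      also have "\<dots> = (real (Suc m))\<^sup>2 * (\<Sum>e\<in>F. (r m e)\<^sup>2)"
        by (rule sum_distrib_left[symmetric])
      finally have "real (Suc m) * \<bar>\<Sum>e\<in>F. r m e * Q e x\<bar>
          \<le> real (Suc m) * (sqrt (\<Sum>e\<in>F. (r m e)\<^sup>2) * V x)"
        by (simp only: real_sqrt_mult real_sqrt_abs abs_of_nat mult.assoc)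
      then show ?thesis by (rule mult_left_le_imp_le) simp
    qed
    moreover have "(\<lambda>m. \<bar>\<Sum>e\<in>F. r m e * Q e x\<bar>) \<longlonglongrightarrow> \<bar>\<Sum>e\<in>F. Q e x * Q e x\<bar>"
      by (intro tendsto_intros r_lim)
    moreover have "(\<lambda>m. sqrt (\<Sum>e\<in>F. (r m e)\<^sup>2) * V x) \<longlonglongrightarrow> sqrt s * V x"
      unfolding s_def by (intro tendsto_intros r_lim)
    ultimately have "\<bar>\<Sum>e\<in>F. Q e x * Q e x\<bar> \<le> sqrt s * V x"
      by (intro LIMSEQ_le) auto
    moreover have "0 \<le> s" by (simp add: s_def sum_nonneg)
    ultimately have "sqrt s * sqrt s \<le> sqrt s * V x"
      by (simp add: s_def power2_eq_square)
    \<comment> \<open>Cancelling sqrt s requires s > 0; for s = 0 the claim is V x \<ge> 0.\<close>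
    then have "sqrt s \<le> V x"
      using \<open>0 \<le> s\<close> elim(2) mult_left_le_imp_le[of "sqrt s" "sqrt s" "V x"]
      by (cases "s = 0") auto
    then show ?case
      using \<open>0 \<le> s\<close> by (simp add: sqrt_le_D flip: s_def)
  qed
qed

lemma sum_norm_orthonormal_le:
  assumes V: "V \<in> Lp_space 2 M" and F: "finite F" "F \<subseteq> Lp_space 2 M" "orthonormal M F"
  shows "(\<Sum>e\<in>F. (L2_norm M (Q e))\<^sup>2) \<le> (\<integral>x. (V x)\<^sup>2 \<partial>M)"
proof -
  have int: "integrable M (\<lambda>x. (Q e x)\<^sup>2)" if "e \<in> F" for e
    using Q_L2[of e] F(2) that by (auto simp: Lp_space_2 power2_eq_square)
  have "(\<Sum>e\<in>F. (L2_norm M (Q e))\<^sup>2) = (\<Sum>e\<in>F. \<integral>x. (Q e x)\<^sup>2 \<partial>M)"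
    by (simp add: L2_norm_sq L2_inner_def flip: power2_eq_square)
  also have "\<dots> = (\<integral>x. (\<Sum>e\<in>F. (Q e x)\<^sup>2) \<partial>M)"
    using int by simp
  also have "\<dots> \<le> (\<integral>x. (V x)\<^sup>2 \<partial>M)"
    using V orthonormal_pointwise_bound[OF F] int
    by (intro integral_mono_AE Bochner_Integration.integrable_sum) (auto simp: Lp_space_2 power2_eq_square)
  finally show ?thesis .
qed

section \<open>Extension to integrable functions and construction of the kernel\<close>

lemma pairing_integrable:
  assumes h: "integrable M h" and v: "v \<in> Lp_space 2 M"
  shows "integrable M (\<lambda>x. h x * (Q v x / V x))"
    and "AE x in M. \<bar>h x * (Q v x / V x)\<bar> \<le> L2_norm M v * \<bar>h x\<bar>"
proof -
  note [measurable] = borel_measurable_integrable[OF h] Lp_space_2_measurable[OF Q_L2[OF v]]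
  show *: "AE x in M. \<bar>h x * (Q v x / V x)\<bar> \<le> L2_norm M v * \<bar>h x\<bar>"
    using pointwise_bound[OF v] AE_V_pos
  proof eventually_elim
    case (elim x)
    \<comment> \<open>So v |-> Q v / V contracts L^2 into the bounded functions. The pairing with
      \<open>h\<close> is the transpose of this map, and it is what characterises the extension to
      L^1.\<close>
    then have "\<bar>Q v x / V x\<bar> \<le> L2_norm M v" by (simp add: abs_divide pos_divide_le_eq)
    then have "\<bar>h x\<bar> * \<bar>Q v x / V x\<bar> \<le> \<bar>h x\<bar> * L2_norm M v"
      by (rule mult_left_mono) simp
    then show ?case by (simp only: abs_mult mult.commute)
  qed
  have "integrable M (\<lambda>x. L2_norm M v * \<bar>h x\<bar>)" using h by simp
  then show "integrable M (\<lambda>x. h x * (Q v x / V x))"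
    by (rule Bochner_Integration.integrable_bound) (use * in \<open>auto elim!: eventually_mono\<close>)
qed

text \<open>
  The operator \<open>h \<mapsto> Q (h / V)\<close> extends to \<open>L\<^sup>1\<close>; the extension is characterised weakly, which makes
  its linearity immediate.
\<close>

lemma extension_exists:
  assumes h: "integrable M h"
  shows "\<exists>u\<in>Lp_space 2 M. \<forall>v\<in>Lp_space 2 M. L2_inner M u v = (\<integral>x. h x * (Q v x / V x) \<partial>M)"
proof -
  note [measurable] = borel_measurable_integrable[OF h]
  \<comment> \<open>Truncations of h / V: where |h| \<le> n V^2 one has (h / V)^2 \<le> n |h|, so
    g_n is square integrable. The tail \<open>t n\<close> is what h loses, in absolute
    value.\<close>
  define g where "g n x = (if \<bar>h x\<bar> \<le> real n * (V x)\<^sup>2 then h x / V x else 0)" for n x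
  define t where "t n x = (if \<bar>h x\<bar> \<le> real n * (V x)\<^sup>2 then 0 else \<bar>h x\<bar>)" for n x
  have [measurable]: "g n \<in> borel_measurable M" "t n \<in> borel_measurable M" for n
    unfolding g_def t_def by measurable
  have g_sq: "\<bar>g n x * g n x\<bar> \<le> real n * \<bar>h x\<bar>" if "0 < V x" for n x
  proof (cases "\<bar>h x\<bar> \<le> real n * (V x)\<^sup>2")
    case True
    then have "\<bar>h x\<bar> * \<bar>h x\<bar> \<le> \<bar>h x\<bar> * (real n * (V x)\<^sup>2)"
      by (rule mult_left_mono) simp
    then show ?thesis
      using True that by (simp add: g_def abs_mult power2_eq_square field_simps)
  qed (simp add: g_def)
  have g: "g n \<in> Lp_space 2 M" for n
  proof -
    have "integrable M (\<lambda>x. real n * \<bar>h x\<bar>)" using h by simp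
    then have "integrable M (\<lambda>x. g n x * g n x)"
      by (rule Bochner_Integration.integrable_bound)
         (use AE_V_pos g_sq in \<open>auto elim!: eventually_mono simp del: abs_mult_self_eq\<close>)
    then show ?thesis by (simp add: Lp_space_2)
  qed
  have eventually_all: "\<forall>\<^sub>F n in sequentially. \<bar>h x\<bar> \<le> real n * (V x)\<^sup>2" if Vx: "0 < V x" for x
  proof -
    obtain n0 where "\<bar>h x\<bar> \<le> real n0 * (V x)\<^sup>2"
      using ex_less_of_nat_mult[OF zero_less_power[OF Vx], of "\<bar>h x\<bar>" 2] less_imp_le by blast
    then have "\<bar>h x\<bar> \<le> real n * (V x)\<^sup>2" if "n0 \<le> n" for n
      using that mult_right_mono[of "real n0" "real n" "(V x)\<^sup>2"] by fastforce
    then show ?thesis unfolding eventually_sequentially by blast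
  qed
  have t_int: "integrable M (t n)" for n
    by (rule Bochner_Integration.integrable_bound[OF h]) (auto simp: t_def)
  have "(\<lambda>n. \<integral>x. t n x \<partial>M) \<longlonglongrightarrow> (\<integral>x. 0 \<partial>M)"
  proof (rule integral_dominated_convergence[where w = "\<lambda>x. \<bar>h x\<bar>"])
    show "AE x in M. (\<lambda>n. t n x) \<longlonglongrightarrow> 0"
      using AE_V_pos
    proof eventually_elim
      case (elim x)
      show ?case
        by (intro tendsto_eventually eventually_mono[OF eventually_all[OF elim]]) (simp add: t_def)
    qed
  qed (use h in \<open>auto simp: t_def\<close>)
  then have t_lim: "(\<lambda>n. \<integral>x. t n x \<partial>M) \<longlonglongrightarrow> 0" by simp
  \<comment> \<open>For m, n \<ge> N both truncations equal h / V where |h| \<le> N V^2, and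
    elsewhere they differ by at most |h| / V. Hence |g_m - g_n| V is at most the tail, and the
    domination makes Q g_n Cauchy.\<close>
  have diff_le: "L2_norm M (\<lambda>x. Q (g m) x - Q (g n) x) \<le> (\<integral>x. t N x \<partial>M)" if "N \<le> m" "N \<le> n" for m n N
  proof -
    let ?d = "\<lambda>x. g m x - g n x"
    have d: "?d \<in> Lp_space 2 M" by (intro L2_diff g)
    have pt: "\<bar>?d x * V x\<bar> \<le> t N x" if "0 < V x" for x
    proof (cases "\<bar>h x\<bar> \<le> real N * (V x)\<^sup>2")
      case True
      have "\<bar>h x\<bar> \<le> real k * (V x)\<^sup>2" if "N \<le> k" for k
        using True that mult_right_mono[of "real N" "real k" "(V x)\<^sup>2"] by fastforce
      then show ?thesis using \<open>N \<le> m\<close> \<open>N \<le> n\<close> by (simp add: g_def t_def)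
    next
      case False
      with that show ?thesis by (auto simp: g_def t_def)
    qed
    have int: "integrable M (\<lambda>x. ?d x * V x)"
      by (rule Bochner_Integration.integrable_bound[OF t_int[of N]])
         (use AE_V_pos pt in \<open>auto elim!: eventually_mono intro: order_trans[OF _ abs_ge_self]\<close>)
    have "L2_norm M (\<lambda>x. Q (g m) x - Q (g n) x) = L2_norm M (Q ?d)"
      using operator_diff[OF bounded g g, of m n]
      by (intro L2_norm_cong_AE L2_diff Q_L2 d g) (auto elim!: eventually_mono)
    also have "\<dots> \<le> (\<integral>x. \<bar>?d x * V x\<bar> \<partial>M)" by (rule dominated_integral[OF d int])
    also have "\<dots> \<le> (\<integral>x. t N x \<partial>M)"
      using int t_int AE_V_pos pt by (intro integral_mono_AE) (auto elim!: eventually_mono)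
    finally show ?thesis .
  qed
  have "\<exists>N. \<forall>m\<ge>N. \<forall>n\<ge>N. L2_norm M (\<lambda>x. Q (g m) x - Q (g n) x) < e" if e: "0 < e" for e
  proof -
    obtain N where "(\<integral>x. t N x \<partial>M) < e"
      using order_tendstoD(2)[OF t_lim e] by (auto simp: eventually_sequentially)
    then show ?thesis using diff_le by (meson order_le_less_trans)
  qed
  then obtain u where u: "u \<in> Lp_space 2 M"
    and lim: "(\<lambda>n. L2_norm M (\<lambda>x. Q (g n) x - u x)) \<longlonglongrightarrow> 0"
    using L2_complete[of "\<lambda>n. Q (g n)"] Q_L2[OF g] by blast
  have "L2_inner M u v = (\<integral>x. h x * (Q v x / V x) \<partial>M)" if v: "v \<in> Lp_space 2 M" for v
  proof (rule LIMSEQ_unique)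
    note [measurable] = Lp_space_2_measurable[OF Q_L2[OF v]]
    have "(\<lambda>n. L2_inner M (Q (g n)) v - L2_inner M u v) \<longlonglongrightarrow> 0"
    proof (rule Lim_null_comparison)
      show "(\<lambda>n. L2_norm M (\<lambda>x. Q (g n) x - u x) * L2_norm M v) \<longlonglongrightarrow> 0"
        using tendsto_mult_right[OF lim, of "L2_norm M v"] by simp
      show "\<forall>\<^sub>F n in sequentially. norm (L2_inner M (Q (g n)) v - L2_inner M u v)
          \<le> L2_norm M (\<lambda>x. Q (g n) x - u x) * L2_norm M v"
        using L2_Cauchy_Schwarz[OF L2_diff[OF Q_L2[OF g] u] v]
        by (simp add: L2_inner_diff_left[OF Q_L2[OF g] u v])
    qed
    then show "(\<lambda>n. L2_inner M (Q (g n)) v) \<longlonglongrightarrow> L2_inner M u v"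
      by (simp add: LIM_zero_iff)
    \<comment> \<open>By symmetry the integrals are <Q g_n, v>; here Q v stays fixed while g_n tends
      to h / V.\<close>
    have "(\<lambda>n. \<integral>x. g n x * Q v x \<partial>M) \<longlonglongrightarrow> (\<integral>x. h x * (Q v x / V x) \<partial>M)"
    proof (rule integral_dominated_convergence[where w = "\<lambda>x. L2_norm M v * \<bar>h x\<bar>"])
      show "AE x in M. (\<lambda>n. g n x * Q v x) \<longlonglongrightarrow> h x * (Q v x / V x)"
        using AE_V_pos
      proof eventually_elim
        case (elim x)
        show ?case
          by (intro tendsto_eventually eventually_mono[OF eventually_all[OF elim]]) (simp add: g_def)
      qed
      show "AE x in M. norm (g n x * Q v x) \<le> L2_norm M v * \<bar>h x\<bar>" for n
        using pairing_integrable(2)[OF h v]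
        by eventually_elim (auto simp: g_def intro: order_trans[rotated])
    qed (use h in auto)
    then show "(\<lambda>n. L2_inner M (Q (g n)) v) \<longlonglongrightarrow> (\<integral>x. h x * (Q v x / V x) \<partial>M)"
      by (simp add: inner_symmetric[OF g v]) (simp add: L2_inner_def)
  qed
  with u show ?thesis by blast
qed

lemma AE_eq_if_inner_eq:
  assumes "u \<in> Lp_space 2 M" "u' \<in> Lp_space 2 M"
    and "\<And>v. v \<in> Lp_space 2 M \<Longrightarrow> L2_inner M u v = L2_inner M u' v"
  shows "AE x in M. u x = u' x"
proof -
  have d: "(\<lambda>x. u x - u' x) \<in> Lp_space 2 M" using assms(1,2) by (rule L2_diff)
  have "L2_norm M (\<lambda>x. u x - u' x) = 0"
    using assms(3)[OF d] L2_inner_diff_left[OF assms(1,2) d] by (simp add: L2_norm_def)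
  then have "AE x in M. u x - u' x = 0" using L2_norm_eq_0_iff[OF d] by blast
  then show ?thesis by eventually_elim simp
qed

lemma extension_operator:
  obtains J where "\<And>h. integrable M h \<Longrightarrow> J h \<in> Lp_space 2 M"
    and "\<And>h v. integrable M h \<Longrightarrow> v \<in> Lp_space 2 M \<Longrightarrow>
      L2_inner M (J h) v = (\<integral>x. h x * (Q v x / V x) \<partial>M)"
proof -
  have "\<forall>h. \<exists>u. integrable M h \<longrightarrow> u \<in> Lp_space 2 M \<and>
      (\<forall>v\<in>Lp_space 2 M. L2_inner M u v = (\<integral>x. h x * (Q v x / V x) \<partial>M))"
    using extension_exists by blast
  then obtain J where "\<forall>h. integrable M h \<longrightarrow> J h \<in> Lp_space 2 M \<and>
      (\<forall>v\<in>Lp_space 2 M. L2_inner M (J h) v = (\<integral>x. h x * (Q v x / V x) \<partial>M))"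
    by metis
  then show ?thesis using that by blast
qed

lemma kernel_representation:
  assumes nice: "nice_measure_space M"
  shows "\<exists>q. represented_by_kernel M {f \<in> Lp_space 2 M. Lp_norm 1 M (\<lambda>x. f x * V x) < \<infinity>}
      (\<lambda>f. Q (Q f)) q \<and> (AE (x, y) in M \<Otimes>\<^sub>M M. \<bar>q (x, y)\<bar> \<le> V x * V y)"
proof -
  obtain J where J: "\<And>h. integrable M h \<Longrightarrow> J h \<in> Lp_space 2 M"
    and J_inner: "\<And>h v. integrable M h \<Longrightarrow> v \<in> Lp_space 2 M \<Longrightarrow>
      L2_inner M (J h) v = (\<integral>x. h x * (Q v x / V x) \<partial>M)"
    using extension_operator by blast
  \<comment> \<open>Any L^2 function with the pairings prescribed for \<open>h\<close> has the same
    image under \<open>Q\<close> as \<open>J h\<close>. The operator laws for \<open>T\<close> below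
    and the identification of J (f V) with Q f are instances.\<close>
  have J_unique: "AE x in M. Q (J h) x = Q u x"
    if h: "integrable M h" and u: "u \<in> Lp_space 2 M"
      and "\<And>v. v \<in> Lp_space 2 M \<Longrightarrow> L2_inner M u v = (\<integral>x. h x * (Q v x / V x) \<partial>M)" for h u
    using that J_inner[OF h]
    by (intro operator_cong[OF bounded] J AE_eq_if_inner_eq) auto
  \<comment> \<open>Testing the weak identity with v = J h gives ||J h||^2 \<le> ||J h|| times the
    L^1 norm of h.\<close>
  have J_norm: "L2_norm M (J h) \<le> (\<integral>x. \<bar>h x\<bar> \<partial>M)" if h: "integrable M h" for h
  proof (cases "L2_norm M (J h) = 0")
    case False
    have "L2_norm M (J h) * L2_norm M (J h) = (\<integral>x. h x * (Q (J h) x / V x) \<partial>M)"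
      using J_inner[OF h J[OF h]] by (simp add: power2_eq_square flip: L2_norm_sq)
    also have "\<dots> \<le> (\<integral>x. L2_norm M (J h) * \<bar>h x\<bar> \<partial>M)"
      using pairing_integrable[OF h J[OF h]] h
      by (intro integral_mono_AE) (auto elim!: eventually_mono dest: abs_le_D1 simp del: times_divide_eq_right)
    also have "\<dots> = L2_norm M (J h) * (\<integral>x. \<bar>h x\<bar> \<partial>M)" by simp
    finally show ?thesis
      by (rule mult_left_le_imp_le) (use False in \<open>simp add: order_less_le\<close>)
  qed simp
  define T where "T h = (\<lambda>x. Q (J h) x / V x)" for h
  have T_measurable: "T h \<in> borel_measurable M" if "integrable M h" for h
    using Lp_space_2_measurable[OF Q_L2[OF J[OF that]]] unfolding T_def by measurable
  have T_norm: "Lp_norm \<infinity> M (T h) \<le> Lp_norm 1 M h" if h: "integrable M h" for h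
  proof -
    have le: "AE x in M. ennreal \<bar>T h x\<bar> \<le> ennreal (\<integral>x. \<bar>h x\<bar> \<partial>M)"
      using pointwise_bound[OF J[OF h]] AE_V_pos
    proof eventually_elim
      case (elim x)
      then have "\<bar>T h x\<bar> \<le> L2_norm M (J h)"
        by (simp add: T_def abs_divide pos_divide_le_eq)
      then show ?case using J_norm[OF h] by (intro ennreal_leI) linarith
    qed
    have "(\<lambda>x. ennreal \<bar>T h x\<bar>) \<in> borel_measurable M"
      using T_measurable[OF h] by measurable
    then show ?thesis
      using esssup_I[OF _ le] by (simp only: Lp_norm_1_integrable[OF h]) (simp add: Lp_norm_def)
  qed
  \<comment> \<open>This 1 becomes the bound |k| \<le> 1 for the kernel that niceness
    provides.\<close>
  have op_norm_T: "op_norm 1 \<infinity> M T \<le> 1"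
    unfolding op_norm_def by (rule Inf_lower) (use T_norm in \<open>auto simp: Lp_space_1\<close>)
  have "bounded_operator 1 \<infinity> M T"
    unfolding bounded_operator_def
  proof (intro conjI ballI allI impI)
    show "T \<in> Lp_space 1 M \<rightarrow> Lp_space \<infinity> M"
    proof
      fix h assume "h \<in> Lp_space 1 M"
      then have h: "integrable M h" by (simp add: Lp_space_1)
      have "Lp_norm \<infinity> M (T h) < \<infinity>"
        using T_norm[OF h] by (rule order_le_less_trans) (simp add: Lp_norm_1_integrable[OF h])
      with T_measurable[OF h] show "T h \<in> Lp_space \<infinity> M" unfolding Lp_space_def by blast
    qed
    show "op_norm 1 \<infinity> M T < \<infinity>"
      using op_norm_T by (rule order_le_less_trans) simp
  next
    fix f g assume "f \<in> Lp_space 1 M" "g \<in> Lp_space 1 M" and eq: "AE x in M. f x = g x"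
    then have fg: "integrable M f" "integrable M g" by (auto simp: Lp_space_1)
    have "AE x in M. Q (J f) x = Q (J g) x"
    proof (rule J_unique[OF fg(1) J[OF fg(2)]])
      fix v assume v: "v \<in> Lp_space 2 M"
      have "(\<integral>x. f x * (Q v x / V x) \<partial>M) = (\<integral>x. g x * (Q v x / V x) \<partial>M)"
        using pairing_integrable(1)[OF fg(1) v] pairing_integrable(1)[OF fg(2) v] eq
        by (intro integral_cong_AE) (auto elim!: eventually_mono)
      then show "L2_inner M (J g) v = (\<integral>x. f x * (Q v x / V x) \<partial>M)"
        using J_inner[OF fg(2) v] by simp
    qed
    then show "AE x in M. T f x = T g x" unfolding T_def by eventually_elim simp
  next
    fix f g assume "f \<in> Lp_space 1 M" "g \<in> Lp_space 1 M"
    then have fg: "integrable M f" "integrable M g" by (auto simp: Lp_space_1)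
    have "AE x in M. Q (J (\<lambda>y. f y + g y)) x = Q (\<lambda>y. J f y + J g y) x"
      using fg J_inner pairing_integrable(1)
      by (intro J_unique L2_add J) (simp_all add: L2_inner_add_left J distrib_right add_divide_distrib)
    then show "AE x in M. T (\<lambda>y. f y + g y) x = T f x + T g x"
      using operator_add[OF bounded J[OF fg(1)] J[OF fg(2)]]
      unfolding T_def by eventually_elim (simp add: add_divide_distrib)
  next
    fix f c assume "f \<in> Lp_space 1 M"
    then have f: "integrable M f" by (simp add: Lp_space_1)
    have "AE x in M. Q (J (\<lambda>y. c * f y)) x = Q (\<lambda>y. c * J f y) x"
      using f J_inner
      by (intro J_unique L2_scale J) (simp_all add: L2_inner_scale_left mult.assoc del: times_divide_eq_right)
    then show "AE x in M. T (\<lambda>y. c * f y) x = c * T f x"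
      using operator_scale[OF bounded J[OF f], of c]
      unfolding T_def by eventually_elim simp
  qed
  then obtain k where k: "represented_by_kernel M (Lp_space 1 M) T k"
    and k_le: "AE z in M \<Otimes>\<^sub>M M. ennreal \<bar>k z\<bar> \<le> op_norm 1 \<infinity> M T"
    using nice unfolding nice_measure_space_def by blast
  have [measurable]: "k \<in> borel_measurable (M \<Otimes>\<^sub>M M)"
    using k by (simp add: represented_by_kernel_def)
  \<comment> \<open>\<open>k\<close> represents h |-> Q (J h) / V and is applied to h = f V: the
    factor V(x) undoes the division, and V(y) is the weight contained in h.\<close>
  define q where "q z = k z * (V (fst z) * V (snd z))" for z
  have "q \<in> borel_measurable (M \<Otimes>\<^sub>M M)" unfolding q_def by measurable
  moreover have "AE x in M. integrable M (\<lambda>y. q (x, y) * f y) \<and> Q (Q f) x = (\<integral>y. q (x, y) * f y \<partial>M)"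
    if f: "f \<in> Lp_space 2 M" and fin: "Lp_norm 1 M (\<lambda>x. f x * V x) < \<infinity>" for f
  proof -
    have int: "integrable M (\<lambda>x. f x * V x)"
      using fin Lp_space_2_measurable[OF f] by (auto simp: Lp_norm_1 integrable_iff_bounded)
    \<comment> \<open>Q f has the pairings that characterise J (f V), because f Q v = (f V) (Q v /
      V).\<close>
    have "L2_inner M (Q f) v = (\<integral>x. f x * V x * (Q v x / V x) \<partial>M)" if v: "v \<in> Lp_space 2 M" for v
      unfolding inner_symmetric[OF f v] unfolding L2_inner_def
    proof (rule Bochner_Integration.integral_cong[OF refl])
      fix x assume "x \<in> space M"
      then show "f x * Q v x = f x * V x * (Q v x / V x)"
        using V_pos[of x] by simp
    qed
    then have "AE x in M. Q (J (\<lambda>x. f x * V x)) x = Q (Q f) x"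
      by (rule J_unique[OF int Q_L2[OF f]])
    moreover have "AE x in M. integrable M (\<lambda>y. k (x, y) * (f y * V y)) \<and>
        T (\<lambda>x. f x * V x) x = (\<integral>y. k (x, y) * (f y * V y) \<partial>M)"
      using k int by (simp add: represented_by_kernel_def Lp_space_1)
    ultimately show ?thesis
      using AE_V_pos
    proof eventually_elim
      case (elim x)
      have eq: "(\<lambda>y. q (x, y) * f y) = (\<lambda>y. V x * (k (x, y) * (f y * V y)))"
        by (simp add: q_def mult_ac)
      have "Q (Q f) x = V x * T (\<lambda>x. f x * V x) x"
        using elim(1,3) by (simp add: T_def)
      then show ?case using elim unfolding eq by simp
    qed
  qed
  moreover have "AE (x, y) in M \<Otimes>\<^sub>M M. \<bar>q (x, y)\<bar> \<le> V x * V y"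
    using k_le AE_space
  proof eventually_elim
    case (elim z)
    then have "0 < V (fst z) * V (snd z)"
      by (auto simp: space_pair_measure intro!: mult_pos_pos V_pos)
    moreover have "\<bar>k z\<bar> \<le> 1"
      using order_trans[OF elim(1) op_norm_T] by simp
    ultimately have "\<bar>k z\<bar> * (V (fst z) * V (snd z)) \<le> V (fst z) * V (snd z)"
      by (intro mult_left_le_one_le) auto
    then have "\<bar>q z\<bar> \<le> V (fst z) * V (snd z)"
      unfolding q_def abs_mult[of "k z"] abs_of_pos[OF \<open>0 < V (fst z) * V (snd z)\<close>] .
    then show ?case by (simp add: case_prod_beta)
  qed
  ultimately show ?thesis
    unfolding represented_by_kernel_def by blast
qed

end

theorem proposition2p1:
  fixes M :: "'a measure"
    and Q :: "('a \<Rightarrow> real) \<Rightarrow> ('a \<Rightarrow> real)"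
    and V :: "'a \<Rightarrow> real"
  assumes "sigma_finite_measure M"
    and "nice_measure_space M"
    and "bounded_operator 2 2 M Q"
    and "symmetric_operator M Q"
    and "V \<in> borel_measurable M"
    and "\<And>x. x \<in> space M \<Longrightarrow> 0 < V x"
  shows
    "((\<forall>f \<in> Lp_space 2 M. Lp_norm 2 M (Q f) \<le> Lp_norm 1 M (\<lambda>x. f x * V x))
      \<longleftrightarrow>
      (\<exists>q2. represented_by_kernel M
               {f \<in> Lp_space 2 M. Lp_norm 1 M (\<lambda>x. f x * V x) < \<infinity>} (\<lambda>f. Q (Q f)) q2 \<and>
            (AE (x, y) in M \<Otimes>\<^sub>M M. \<bar>q2 (x, y)\<bar> \<le> V x * V y)))
     \<and>
     ((\<forall>f \<in> Lp_space 2 M. Lp_norm 2 M (Q f) \<le> Lp_norm 1 M (\<lambda>x. f x * V x)) \<and> V \<in> Lp_space 2 M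
      \<longrightarrow>
      Hilbert_Schmidt M Q \<and>
      (\<exists>B \<mu>. discrete_spectrum M Q B \<mu> \<and>
             (\<lambda>e. (\<mu> e)\<^sup>2) summable_on B \<and>
             (\<Sum>\<^sub>\<infinity>e\<in>B. (\<mu> e)\<^sup>2) \<le> (\<integral>x. (V x)\<^sup>2 \<partial>M)))"
proof (intro conjI impI iffI)
  interpret weighted_symmetric_operator M Q V
    using assms by (simp add: weighted_symmetric_operator_def weighted_symmetric_operator_axioms_def)
  let ?dom = "\<forall>f \<in> Lp_space 2 M. Lp_norm 2 M (Q f) \<le> Lp_norm 1 M (\<lambda>x. f x * V x)"
  have dominated: "dominated_symmetric_operator M Q V" if ?dom
    using that by unfold_locales blast
  show "\<exists>q2. represented_by_kernel M {f \<in> Lp_space 2 M. Lp_norm 1 M (\<lambda>x. f x * V x) < \<infinity>}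
      (\<lambda>f. Q (Q f)) q2 \<and> (AE (x, y) in M \<Otimes>\<^sub>M M. \<bar>q2 (x, y)\<bar> \<le> V x * V y)" if ?dom
    using dominated_symmetric_operator.kernel_representation[OF dominated[OF that] assms(2)] .
  show ?dom if "\<exists>q2. represented_by_kernel M
        {f \<in> Lp_space 2 M. Lp_norm 1 M (\<lambda>x. f x * V x) < \<infinity>} (\<lambda>f. Q (Q f)) q2 \<and>
      (AE (x, y) in M \<Otimes>\<^sub>M M. \<bar>q2 (x, y)\<bar> \<le> V x * V y)"
    using that dominated_if_kernel_bound by blast
  define C where "C = (\<integral>x. (V x)\<^sup>2 \<partial>M)"
  assume asm: "?dom \<and> V \<in> Lp_space 2 M"
  interpret dominated_symmetric_operator M Q V using asm dominated by blast
  \<comment> \<open>The integrated pointwise bound supplies the trace hypothesis, with the integral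
    of V^2 as its constant.\<close>
  interpret symmetric_trace_bounded M Q C
    using sum_norm_orthonormal_le asm by unfold_locales (auto simp: C_def bounded symmetric)
  obtain B \<mu> where spec: "discrete_spectrum M Q B \<mu>"
    and Q_norm: "\<And>e. e \<in> B \<Longrightarrow> L2_norm M (Q e) = \<bar>\<mu> e\<bar>"
    using exists_discrete_spectrum by blast
  then have basis: "orthonormal_basis M (Lp_space 2 M) B"
    by (simp add: discrete_spectrum_def)
  then have B: "B \<subseteq> Lp_space 2 M" "orthonormal M B" by (auto simp: orthonormal_basis_iff)
  have sum_le: "(\<Sum>e\<in>F. (\<mu> e)\<^sup>2) \<le> C" if F: "finite F" "F \<subseteq> B" for F
  proof -
    have "(\<Sum>e\<in>F. (\<mu> e)\<^sup>2) = (\<Sum>e\<in>F. (L2_norm M (Q e))\<^sup>2)"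
      using Q_norm F(2) by (intro sum.cong) auto
    also have "\<dots> \<le> C"
      using F B orthonormal_subset[OF B(2) F(2)] by (intro trace_bound) auto
    finally show ?thesis .
  qed
  \<comment> \<open>\<open>B\<close> may be uncountable; summability is unconditional and follows
    from the common bound on finite partial sums.\<close>
  have summable: "(\<lambda>e. (\<mu> e)\<^sup>2) summable_on B"
    by (rule nonneg_bdd_above_summable_on) (use sum_le in \<open>auto intro!: bdd_aboveI[of _ C]\<close>)
  then have "(\<Sum>\<^sub>\<infinity>e\<in>B. (\<mu> e)\<^sup>2) \<le> C"
    using sum_le by (intro infsum_le_finite_sums) auto
  with spec summable show "\<exists>B \<mu>. discrete_spectrum M Q B \<mu> \<and> (\<lambda>e. (\<mu> e)\<^sup>2) summable_on B \<and>
      (\<Sum>\<^sub>\<infinity>e\<in>B. (\<mu> e)\<^sup>2) \<le> (\<integral>x. (V x)\<^sup>2 \<partial>M)"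
    unfolding C_def by blast
  \<comment> \<open>The eigenbasis itself witnesses the Hilbert-Schmidt property, because ||Q e|| =
    |\<mu> e| on it.\<close>
  have "(\<Sum>\<^sub>\<infinity>e\<in>B. (Lp_norm 2 M (Q e))\<^sup>2) \<le> ennreal C"
  proof (rule infsum_le_finite_sums)
    show "(\<lambda>e. (Lp_norm 2 M (Q e))\<^sup>2) summable_on B"
      by (rule nonneg_summable_on_complete) simp
    fix F assume F: "finite F" "F \<subseteq> B"
    have "(\<Sum>e\<in>F. (Lp_norm 2 M (Q e))\<^sup>2) = (\<Sum>e\<in>F. ennreal ((\<mu> e)\<^sup>2))"
    proof (rule sum.cong[OF refl])
      fix e assume "e \<in> F"
      then have "e \<in> B" using F by blast
      then show "(Lp_norm 2 M (Q e))\<^sup>2 = ennreal ((\<mu> e)\<^sup>2)"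
        using B by (simp add: Lp_norm_2[OF Q_L2] subset_iff Q_norm ennreal_power)
    qed
    also have "\<dots> = ennreal (\<Sum>e\<in>F. (\<mu> e)\<^sup>2)" by (simp add: sum_ennreal)
    also have "\<dots> \<le> ennreal C" using sum_le[OF F] by (rule ennreal_leI)
    finally show "(\<Sum>e\<in>F. (Lp_norm 2 M (Q e))\<^sup>2) \<le> ennreal C" .
  qed
  then have "(\<Sum>\<^sub>\<infinity>e\<in>B. (Lp_norm 2 M (Q e))\<^sup>2) < \<infinity>"
    by (simp add: order_le_less_trans)
  with basis bounded show "Hilbert_Schmidt M Q"
    unfolding Hilbert_Schmidt_def by blast
qed

end
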